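(* Let $d=2$ and let $\mathbb{P}$ be a probability measure on $\Omega=\mathbb{R}^{\mathcal{E}^2}$ satisfying assumptions A1 and A2 below. Then $\mathbb{P}$-almost surely, the undirected nearest neighbor graph $\mathcal{N}$ has at most two infinite connected components.
   Context: $\mathcal{E}^2$ is the set of nearest-neighbor edges $\{x,y\}$ ($\|x-y\|_1=1$) of $\mathbb{Z}^2$; $\Omega$ carries the product Borel sigma-algebra and $\omega\in\Omega$ assigns a weight $\omega(e)$ to each edge. A1 (translation invariance): for every $z\in\mathbb{Z}^2$, $\mathbb{P}=\mathbb{P}\circ T_z^{-1}$ where $(T_z\omega)(e)=\omega(e+z)$, $e+z=\{x+z,y+z\}$ for $e=\{x,y\}$. A2: for distinct $e,f\in\mathcal{E}^2$, $\mathbb{P}(\omega(e)=\omega(f))=0$. The directed nearest neighbor graph $\mathcal{N}_D$ has vertex set $\mathbb{Z}^2$ and directed edges $\langle x,y\rangle$ for all $\{x,y\}\in\mathcal{E}^2$ with $\omega(\{x,y\})\le\omega(\{x,z\})$ for all $z$ with $\{x,z\}\in\mathcal{E}^2$. The undirected nearest neighbor graph $\mathcal{N}$ has vertex set $\mathbb{Z}^2$ and edge set $\{\{x,y\}:\langle x,y\rangle \text{ is an edge of } \mathcal{N}_D\}$. *)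

theory Defs
  imports "HOL-Probability.Probability"
begin

type_synonym vtx = "int \<times> int"

definition E2 :: "vtx set set" where
  "E2 = {{x, y} | x y. \<bar>fst x - fst y\<bar> + \<bar>snd x - snd y\<bar> = 1}"

definition Omega :: "(vtx set \<Rightarrow> real) measure" where
  "Omega = PiM E2 (\<lambda>_. borel)"

definition shift_vtx :: "vtx \<Rightarrow> vtx \<Rightarrow> vtx" where
  "shift_vtx z x = (fst x + fst z, snd x + snd z)"

definition shift_edge :: "vtx \<Rightarrow> vtx set \<Rightarrow> vtx set" where
  "shift_edge z e = shift_vtx z ` e"

definition T :: "vtx \<Rightarrow> (vtx set \<Rightarrow> real) \<Rightarrow> (vtx set \<Rightarrow> real)" where
  "T z \<omega> = (\<lambda>e\<in>E2. \<omega> (shift_edge z e))"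

definition nn_dir :: "(vtx set \<Rightarrow> real) \<Rightarrow> vtx \<Rightarrow> vtx \<Rightarrow> bool" where
  "nn_dir \<omega> x y \<longleftrightarrow> {x, y} \<in> E2 \<and> (\<forall>z. {x, z} \<in> E2 \<longrightarrow> \<omega> {x, y} \<le> \<omega> {x, z})"

definition nn_adj :: "(vtx set \<Rightarrow> real) \<Rightarrow> vtx \<Rightarrow> vtx \<Rightarrow> bool" where
  "nn_adj \<omega> x y \<longleftrightarrow> nn_dir \<omega> x y \<or> nn_dir \<omega> y x"

definition nn_component :: "(vtx set \<Rightarrow> real) \<Rightarrow> vtx \<Rightarrow> vtx set" where
  "nn_component \<omega> x = {y. (nn_adj \<omega>)\<^sup>*\<^sup>* x y}"

definition infinite_components :: "(vtx set \<Rightarrow> real) \<Rightarrow> vtx set set" where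
  "infinite_components \<omega> = {C. \<exists>x. C = nn_component \<omega> x \<and> infinite C}"

end

theory Submission
  imports Defs
begin

text \<open>
  Almost surely the weights are distinct, so that every vertex has exactly one outgoing edge and
  the weights decrease along directed paths. Let every vertex send unit mass to the first vertex on
  its forward orbit with an incident weight below a rational level \<open>b\<close>. By mass transport each
  vertex receives finite mass, hence backward clusters are finite, and in an infinite component all
  forward orbits are infinite paths without repetition.

  Suppose that with positive probability three infinite components meet a block of radius \<open>r\<close> around
  the origin and the backward clusters of the sites of this block have radius at most \<open>K\<close>. Then, in
  expectation, a positive fraction of the \<open>m\<^sup>2\<close> translates of this block to a sparse grid have
  this property. The forward orbits that leave one such block for good avoid the others. Label each such
  block separately, label these orbits by their component, and attach the remaining sites to them
  along shortest paths outside the blocks: all label classes except the blocks have only infinite connected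
  pieces. So in the graph of dual edges between different labels every even finite subset is
  determined by a set of blocks, which gives \<open>E \<le> V + B\<close> for edges, vertices and blocks in a
  window, up to a boundary term. This graph has no vertex of degree one, and around each block it
  has at least three vertices of degree at least three, so \<open>2 V + 3 B \<le> 2 E\<close>. Thus the number of
  blocks is at most of the order of the boundary, that is \<open>O(m)\<close>, a contradiction.
\<close>

section \<open>Counting branching points of an interface\<close>

text \<open>A pair \<open>(True, (i, j))\<close> stands for the edge from \<open>(i, j)\<close> to \<open>(i + 1, j)\<close>, and
  \<open>(False, (i, j))\<close> for the edge from \<open>(i, j)\<close> to \<open>(i, j + 1)\<close>; \<open>sides v\<close> are the four
  sides of the unit square with lower left corner \<open>v\<close>.\<close>

definition sides :: "vtx \<Rightarrow> (bool \<times> vtx) set" where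
  "sides v = {(True, v), (True, (fst v, snd v + 1)), (False, v), (False, (fst v + 1, snd v))}"

text \<open>Each lattice edge stands for the dual edge crossing it and each unit square for the dual
  vertex at its centre, so \<open>card (sides v \<inter> interface l)\<close> is the degree of a
  dual vertex.\<close>

definition interface :: "(vtx \<Rightarrow> 'l) \<Rightarrow> (bool \<times> vtx) set" where
  "interface l = {(b, x). l x \<noteq> l (if b then (fst x + 1, snd x) else (fst x, snd x + 1))}"

definition lattice_adj :: "vtx \<Rightarrow> vtx \<Rightarrow> bool" where
  "lattice_adj x y \<longleftrightarrow> \<bar>fst x - fst y\<bar> + \<bar>snd x - snd y\<bar> = 1"

definition same_label :: "(vtx \<Rightarrow> 'l) \<Rightarrow> vtx \<Rightarrow> vtx \<Rightarrow> bool" where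
  "same_label l x y \<longleftrightarrow> lattice_adj x y \<and> l x = l y"

text \<open>These are the lattice edges whose dual edges are crossed by the half-line from
  \<open>x\<close> to the right.\<close>

definition ray :: "vtx \<Rightarrow> (bool \<times> vtx) set" where
  "ray x = {(True, (k, snd x)) | k. fst x \<le> k}"

definition crossing_odd :: "(bool \<times> vtx) set \<Rightarrow> vtx \<Rightarrow> bool" where
  "crossing_odd D x \<longleftrightarrow> odd (card (D \<inter> ray x))"

lemma interface_True [simp]: "(True, x) \<in> interface l \<longleftrightarrow> l x \<noteq> l (fst x + 1, snd x)"
  and interface_False [simp]: "(False, x) \<in> interface l \<longleftrightarrow> l x \<noteq> l (fst x, snd x + 1)"
  by (auto simp: interface_def)

lemma lattice_adj_sym: "lattice_adj x y \<Longrightarrow> lattice_adj y x"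
  by (auto simp: lattice_adj_def abs_minus_commute)

lemma lattice_adj_cases:
  assumes "lattice_adj x y"
  obtains "y = (fst x + 1, snd x)" | "x = (fst y + 1, snd y)"
    | "y = (fst x, snd x + 1)" | "x = (fst y, snd y + 1)"
proof -
  have "(fst x = fst y \<and> (snd x = snd y + 1 \<or> snd y = snd x + 1)) \<or>
        (snd x = snd y \<and> (fst x = fst y + 1 \<or> fst y = fst x + 1))"
    using assms unfolding lattice_adj_def by arith
  then show ?thesis using that by (metis prod.collapse)
qed

lemma finite_sides [simp]: "finite (sides v)"
  by (simp add: sides_def)

lemma card_sides_Int:
  "card (sides v \<inter> X) = of_bool ((True, v) \<in> X) + of_bool ((True, (fst v, snd v + 1)) \<in> X)
     + of_bool ((False, v) \<in> X) + of_bool ((False, (fst v + 1, snd v)) \<in> X)"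
proof -
  have "card (sides v \<inter> X) = (\<Sum>e\<in>sides v. of_bool (e \<in> X))"
    by (simp add: of_bool_def sum.If_cases)
  also have "\<dots> = of_bool ((True, v) \<in> X) + of_bool ((True, (fst v, snd v + 1)) \<in> X)
     + of_bool ((False, v) \<in> X) + of_bool ((False, (fst v + 1, snd v)) \<in> X)"
    by (cases v) (simp add: sides_def)
  finally show ?thesis .
qed

text \<open>A closed walk around the square comes back to its first label, so a single change is
  impossible.\<close>

lemma card_sides_interface_neq_1: "card (sides v \<inter> interface l) \<noteq> 1"
  unfolding card_sides_Int by (auto simp: of_bool_def)

section \<open>Parity of crossings along a ray\<close>

lemma ray_step: "ray (i, j) = insert (True, (i, j)) (ray (i + 1, j))"
  by (auto simp: ray_def)

lemma crossing_odd_horizontal: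
  assumes "finite D"
  shows "crossing_odd D (i, j) \<longleftrightarrow> crossing_odd D (i + 1, j) \<noteq> ((True, (i, j)) \<in> D)"
proof -
  have "(True, (i, j)) \<notin> ray (i + 1, j)" by (auto simp: ray_def)
  then show ?thesis
    using assms by (auto simp: crossing_odd_def ray_step[of i j] Int_insert_right)
qed

lemma finite_bounded_support:
  fixes D :: "(bool \<times> vtx) set"
  assumes "finite D"
  obtains M where "M > 0" "\<And>b i j. (b, (i, j)) \<in> D \<Longrightarrow> \<bar>i\<bar> < M \<and> \<bar>j\<bar> < M"
proof -
  define M where "M = Max (insert 1 ((\<lambda>(b, (i, j)). max \<bar>i\<bar> \<bar>j\<bar> + 1) ` D))"
  have "1 \<le> M" unfolding M_def using assms by (intro Max_ge) auto
  moreover have "\<bar>i\<bar> < M \<and> \<bar>j\<bar> < M" if "(b, (i, j)) \<in> D" for b i j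
  proof -
    have "max \<bar>i\<bar> \<bar>j\<bar> + 1 \<le> M" unfolding M_def
      using assms that by (intro Max_ge) force+
    then show ?thesis by auto
  qed
  ultimately show ?thesis using that[of M] by force
qed

text \<open>Leftward induction over columns, starting beyond \<open>D\<close>: evenness at the
  square between columns \<open>i - 1\<close> and \<open>i\<close> transfers the relation between
  rows \<open>j\<close> and \<open>j + 1\<close> from column \<open>i\<close> to column
  \<open>i - 1\<close>.\<close>

lemma crossing_odd_vertical:
  assumes "finite D" and ev: "\<And>v. even (card (sides v \<inter> D))"
  shows "crossing_odd D (i, j) \<longleftrightarrow> crossing_odd D (i, j + 1) \<noteq> ((False, (i, j)) \<in> D)"
proof -
  obtain M where M: "\<And>b i j. (b, (i, j)) \<in> D \<Longrightarrow> \<bar>i\<bar> < M \<and> \<bar>j\<bar> < M"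
    using finite_bounded_support[OF \<open>finite D\<close>] by metis
  have right: "\<not> crossing_odd D (i, j)" if "i \<ge> M" for i j
  proof -
    have "D \<inter> ray (i, j) = {}" using M that by (force simp: ray_def)
    then show ?thesis by (simp add: crossing_odd_def)
  qed
  \<comment> \<open>The column \<open>max i M\<close> lies to the right of all of \<open>D\<close>,
    so all three terms are false there.\<close>
  have "\<forall>j. crossing_odd D (i, j) \<longleftrightarrow> crossing_odd D (i, j + 1) \<noteq> ((False, (i, j)) \<in> D)"
    if "i \<le> max i M" for i
    using that
  proof (induction i rule: int_le_induct[where k = "max i M"])
    case base
    then show ?case using right M by force
  next
    case (step i)
    show ?case
    proof
      fix j
      have "even (of_bool ((True, (i - 1, j)) \<in> D) + of_bool ((True, (i - 1, j + 1)) \<in> D)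
        + of_bool ((False, (i - 1, j)) \<in> D) + of_bool ((False, (i, j)) \<in> D) :: nat)"
        using ev[of "(i - 1, j)"] unfolding card_sides_Int by simp
      then have "(((True, (i - 1, j)) \<in> D) \<noteq> ((True, (i - 1, j + 1)) \<in> D)) =
          (((False, (i - 1, j)) \<in> D) \<noteq> ((False, (i, j)) \<in> D))"
        by (auto simp: of_bool_def split: if_splits)
      moreover have "crossing_odd D (i - 1, j) \<longleftrightarrow> crossing_odd D (i, j) \<noteq> ((True, (i - 1, j)) \<in> D)" for j
        using crossing_odd_horizontal[OF \<open>finite D\<close>, of "i - 1" j] by simp
      moreover have "crossing_odd D (i, j) \<longleftrightarrow> crossing_odd D (i, j + 1) \<noteq> ((False, (i, j)) \<in> D)"
        using step.IH by blast
      ultimately show "crossing_odd D (i - 1, j) \<longleftrightarrow>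
          crossing_odd D (i - 1, j + 1) \<noteq> ((False, (i - 1, j)) \<in> D)"
        by blast
    qed
  qed
  then show ?thesis by (meson max.cobounded1)
qed

lemma finite_vtx_bounded: "finite {x :: vtx. \<bar>fst x\<bar> \<le> M \<and> \<bar>snd x\<bar> \<le> M}"
proof -
  have "{x :: vtx. \<bar>fst x\<bar> \<le> M \<and> \<bar>snd x\<bar> \<le> M} \<subseteq> {-M..M} \<times> {-M..M}" by auto
  then show ?thesis by (rule finite_subset) auto
qed

text \<open>A discrete Jordan curve theorem: \<^const>\<open>crossing_odd\<close> plays the role of the indicator
  of the inside of the even edge set \<open>D\<close>.\<close>

lemma even_subset_of_interface_empty:
  assumes fin: "finite D" and "D \<subseteq> interface l" and ev: "\<And>v. even (card (sides v \<inter> D))"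
    and reg: "\<And>x. infinite {y. (same_label l)\<^sup>*\<^sup>* x y} \<or> (\<exists>b\<in>B. (same_label l)\<^sup>*\<^sup>* x b)"
    and B: "\<And>b. b \<in> B \<Longrightarrow> \<not> crossing_odd D b"
  shows "D = {}"
proof -
  obtain M where M: "\<And>b i j. (b, (i, j)) \<in> D \<Longrightarrow> \<bar>i\<bar> < M \<and> \<bar>j\<bar> < M"
    using finite_bounded_support[OF fin] by metis
  note hor = crossing_odd_horizontal[OF fin] and ver = crossing_odd_vertical[OF fin ev]
  have step: "crossing_odd D x = crossing_odd D y" if "same_label l x y" for x y
  proof -
    obtain i j i' j' where xy: "x = (i, j)" "y = (i', j')" by (cases x, cases y)
    have "lattice_adj x y" and eq: "l x = l y" using that by (auto simp: same_label_def)
    from this(1) show ?thesis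
    proof (cases rule: lattice_adj_cases)
      case 1
      then have "(True, (i, j)) \<notin> D" using xy eq \<open>D \<subseteq> interface l\<close> by auto
      then show ?thesis using hor[of i j] xy 1 by simp
    next
      case 2
      then have "(True, (i', j')) \<notin> D" using xy eq \<open>D \<subseteq> interface l\<close> by auto
      then show ?thesis using hor[of i' j'] xy 2 by simp
    next
      case 3
      then have "(False, (i, j)) \<notin> D" using xy eq \<open>D \<subseteq> interface l\<close> by auto
      then show ?thesis using ver[of i j] xy 3 by simp
    next
      case 4
      then have "(False, (i', j')) \<notin> D" using xy eq \<open>D \<subseteq> interface l\<close> by auto
      then show ?thesis using ver[of i' j'] xy 4 by simp
    qed
  qed
  have steps: "crossing_odd D x = crossing_odd D y" if "(same_label l)\<^sup>*\<^sup>* x y" for x y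
    using that by induction (auto dest: step)
  have row: "\<not> crossing_odd D (i, j)" if "\<bar>j\<bar> \<ge> M \<or> i \<ge> M" for i j
  proof -
    have "D \<inter> ray (i, j) = {}" using M that by (force simp: ray_def)
    then show ?thesis by (simp add: crossing_odd_def)
  qed
  \<comment> \<open>Rays from the left of \<open>D\<close> may meet it. Moving up a column there
    crosses no edge of \<open>D\<close> and ends in a row that avoids \<open>D\<close>.\<close>
  have left: "\<not> crossing_odd D (i, j)" if "i \<le> - M" for i j
  proof -
    have "crossing_odd D (i, j) = crossing_odd D (i, j + int n)" for n
    proof (induction n)
      case (Suc n)
      have "(False, (i, j + int n)) \<notin> D" using M that by force
      then have "crossing_odd D (i, j + int n) = crossing_odd D (i, j + int n + 1)"
        using ver[of i "j + int n"] by simp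
      then show ?case using Suc by (simp add: add_ac)
    qed simp
    from this[of "nat (\<bar>M\<bar> + \<bar>j\<bar>)"] show ?thesis
      using row[of "j + int (nat (\<bar>M\<bar> + \<bar>j\<bar>))" i] by linarith
  qed
  \<comment> \<open>\<open>crossing_odd D\<close> is constant on label-connected pieces; an infinite
    piece leaves the box around \<open>D\<close>, and any other piece meets
    \<open>B\<close>.\<close>
  have zero: "\<not> crossing_odd D x" for x
    using reg[of x]
  proof
    assume inf: "infinite {y. (same_label l)\<^sup>*\<^sup>* x y}"
    then obtain y where "(same_label l)\<^sup>*\<^sup>* x y" "\<not> (\<bar>fst y\<bar> \<le> M \<and> \<bar>snd y\<bar> \<le> M)"
      using finite_vtx_bounded[of M] by (metis (no_types, lifting) finite_subset mem_Collect_eq subsetI)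
    then have "fst y \<le> - M \<or> M \<le> \<bar>snd y\<bar> \<or> M \<le> fst y" by linarith
    then have "\<not> crossing_odd D (fst y, snd y)" using left row by blast
    then show ?thesis using steps[OF \<open>(same_label l)\<^sup>*\<^sup>* x y\<close>] by simp
  next
    assume "\<exists>b\<in>B. (same_label l)\<^sup>*\<^sup>* x b"
    then show ?thesis using B steps by blast
  qed
  have "(b, (i, j)) \<notin> D" for b i j
    using hor[of i j] ver[of i j] zero by (cases b) auto
  then show ?thesis by auto
qed

section \<open>Counting edges, vertices and branching squares\<close>

lemma odd_card_sym_diff:
  assumes "finite S" "finite S'"
  shows "odd (card (X \<inter> ((S - S') \<union> (S' - S)))) \<longleftrightarrow> odd (card (X \<inter> S)) \<noteq> odd (card (X \<inter> S'))"
proof -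
  have "card (X \<inter> S) = card (X \<inter> (S - S')) + card (X \<inter> (S \<inter> S'))"
    using assms by (subst card_Un_disjoint[symmetric]) (auto intro!: arg_cong[of _ _ card])
  moreover have "card (X \<inter> S') = card (X \<inter> (S' - S)) + card (X \<inter> (S \<inter> S'))"
    using assms by (subst card_Un_disjoint[symmetric]) (auto intro!: arg_cong[of _ _ card])
  moreover have "card (X \<inter> ((S - S') \<union> (S' - S))) = card (X \<inter> (S - S')) + card (X \<inter> (S' - S))"
    using assms by (subst card_Un_disjoint[symmetric]) (auto intro!: arg_cong[of _ _ card])
  ultimately show ?thesis by auto
qed

text \<open>Half of Euler's formula, by the pigeonhole principle over the two-element field.\<close>

lemma card_interface_le:
  assumes "finite E" and "E \<subseteq> interface l" and "finite B"
    and reg: "\<And>x. infinite {y. (same_label l)\<^sup>*\<^sup>* x y} \<or> (\<exists>b\<in>B. (same_label l)\<^sup>*\<^sup>* x b)"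
    and "finite V" and V: "\<And>v. sides v \<inter> E \<noteq> {} \<Longrightarrow> v \<in> V"
  shows "card E \<le> card V + card B"
proof -
  \<comment> \<open>With symmetric difference as addition, \<open>f\<close> is linear over the
    two-element field: it records the parity of the degree at each \<open>v\<close> and whether each
    \<open>b\<close> is enclosed. A set in its kernel is even and encloses no point of
    \<open>B\<close>, hence is empty.\<close>
  define f where "f S = ({v \<in> V. odd (card (sides v \<inter> S))}, {b \<in> B. crossing_odd S b})" for S
  have "inj_on f (Pow E)"
  proof (rule inj_onI)
    fix S S' assume S: "S \<in> Pow E" "S' \<in> Pow E" and eq: "f S = f S'"
    let ?D = "(S - S') \<union> (S' - S)"
    have fin: "finite S" "finite S'" using S \<open>finite E\<close> finite_subset by auto
    have "?D = {}"
    proof (rule even_subset_of_interface_empty[OF _ _ _ reg])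
      show "finite ?D" "?D \<subseteq> interface l" using fin S \<open>E \<subseteq> interface l\<close> by auto
      show "even (card (sides v \<inter> ?D))" for v
      proof (cases "v \<in> V")
        case True
        then have "odd (card (sides v \<inter> S)) = odd (card (sides v \<inter> S'))"
          using eq unfolding f_def by blast
        then show ?thesis using odd_card_sym_diff[OF fin] by blast
      next
        case False
        then have "sides v \<inter> E = {}" using V by blast
        then have "sides v \<inter> ?D = {}" using S by auto
        then show ?thesis by simp
      qed
      show "\<not> crossing_odd ?D b" if "b \<in> B" for b
      proof -
        have "crossing_odd S b = crossing_odd S' b" using that eq unfolding f_def by blast
        then show ?thesis using odd_card_sym_diff[OF fin, of "ray b"]
          by (simp add: crossing_odd_def Int_commute)
      qed
    qed
    then show "S = S'" by auto
  qed
  moreover have "f ` Pow E \<subseteq> Pow V \<times> Pow B" by (auto simp: f_def)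
  ultimately have "card (Pow E) \<le> card (Pow V \<times> Pow B)"
    using \<open>finite V\<close> \<open>finite B\<close> by (intro card_inj_on_le[of f]) auto
  then have "(2::nat) ^ card E \<le> 2 ^ (card V + card B)"
    using assms by (simp add: card_Pow card_cartesian_product power_add)
  then show ?thesis by simp
qed

lemma sides_mem_window: 
  assumes "sides u \<inter> sides v \<noteq> {}" "v \<in> {a..<b} \<times> {a..<b}"
  shows "u \<in> {a - 1..<b + 1} \<times> {a - 1..<b + 1}"
  using assms by (cases u; cases v) (auto simp: sides_def)

lemma card_sides_containing:
  assumes "finite W"
  shows "card {v \<in> W. e \<in> sides v} \<le> 2"
proof -
  obtain b i j where e: "e = (b, (i, j))" by (cases e) auto
  have "{v \<in> W. e \<in> sides v} \<subseteq> (if b then {(i, j), (i, j - 1)} else {(i, j), (i - 1, j)})"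
    unfolding e sides_def by auto
  then have "card {v \<in> W. e \<in> sides v} \<le> card (if b then {(i, j), (i, j - 1)} else {(i, j), (i - 1, j)})"
    by (intro card_mono) auto
  also have "\<dots> \<le> 2" by (auto simp: card_insert_if)
  finally show ?thesis .
qed

text \<open>Double counting of degrees. Positive degrees are at least two, so twice the number of
  such vertices plus the number of branching ones is at most the degree sum, hence at most
  \<open>2 * card E\<close>. Bounding \<open>card E\<close> by \<open>card_interface_le\<close>
  makes the terms \<open>2 * card W1\<close> cancel.\<close>

lemma card_branching_le:
  fixes a :: int
  assumes "finite B"
    and reg: "\<And>x. infinite {y. (same_label l)\<^sup>*\<^sup>* x y} \<or> (\<exists>b\<in>B. (same_label l)\<^sup>*\<^sup>* x b)"
    and W: "W = {a..<a + int N} \<times> {a..<a + int N}"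
  shows "card {v \<in> W. 3 \<le> card (sides v \<inter> interface l)} \<le> 2 * card B + 8 * N + 8"
proof -
  define deg where "deg v = card (sides v \<inter> interface l)" for v
  define E where "E = interface l \<inter> (\<Union>v\<in>W. sides v)"
  define W1 where "W1 = {v \<in> W. 0 < deg v}"
  \<comment> \<open>Edges of \<open>E\<close> may also touch squares of this ring around the window;
    its \<open>4 * N + 4\<close> squares enter twice in the final bound.\<close>
  define W2 where "W2 = {a - 1..<a + int N + 1} \<times> {a - 1..<a + int N + 1} - W"
  have finW: "finite W" "finite W1" and finE: "finite E" unfolding W E_def W1_def by auto
  have finW2: "finite W2" by (simp add: W2_def)
  have "card E \<le> card (W1 \<union> W2) + card B"
  proof (rule card_interface_le[OF finE _ \<open>finite B\<close> reg])
    show "E \<subseteq> interface l" by (auto simp: E_def)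
    show "finite (W1 \<union> W2)" using finW finW2 by simp
    fix v assume "sides v \<inter> E \<noteq> {}"
    then obtain u e where "u \<in> W" "e \<in> sides u" "e \<in> sides v" "e \<in> interface l" by (auto simp: E_def)
    then show "v \<in> W1 \<union> W2"
      using sides_mem_window[of v u a "a + int N"] W
      by (auto simp: W1_def W2_def deg_def card_gt_0_iff)
  qed
  moreover have "card W2 = 4 * N + 4"
  proof -
    have "card W2 = (N + 2) * (N + 2) - N * N"
    proof -
      have "card W2 = card ({a - 1..<a + int N + 1} \<times> {a - 1..<a + int N + 1}) - card W"
        unfolding W2_def using finW by (intro card_Diff_subset) (auto simp: W)
      moreover have "nat (a + int N + 1 - (a - 1)) = N + 2" by simp
      ultimately show ?thesis unfolding W by (simp add: card_cartesian_product)
    qed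
    then show ?thesis by simp
  qed
  ultimately have E: "card E \<le> card W1 + (4 * N + 4) + card B"
    using card_Un_le[of W1 W2] by simp
  have "sum deg W = (\<Sum>v\<in>W. \<Sum>e\<in>E. of_bool (e \<in> sides v))"
  proof (rule sum.cong[OF refl])
    fix v assume "v \<in> W"
    then have "sides v \<inter> interface l = {e \<in> E. e \<in> sides v}" by (auto simp: E_def)
    then show "deg v = (\<Sum>e\<in>E. of_bool (e \<in> sides v))"
      using finE by (simp add: deg_def of_bool_def sum.If_cases Int_def)
  qed
  also have "\<dots> = (\<Sum>e\<in>E. \<Sum>v\<in>W. of_bool (e \<in> sides v))" by (rule sum.swap)
  also have "\<dots> \<le> (\<Sum>e\<in>E. 2)"
    using finW card_sides_containing[OF finW(1)]
    by (intro sum_mono) (simp add: of_bool_def sum.If_cases Int_def)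
  finally have deg_le: "sum deg W \<le> 2 * card E" by simp
  have "2 * card W1 + card {v \<in> W. 3 \<le> deg v} = (\<Sum>v\<in>W. 2 * of_bool (0 < deg v) + of_bool (3 \<le> deg v))"
    using finW by (simp add: W1_def sum.distrib of_bool_def sum.If_cases Int_def sum_distrib_left[symmetric])
  also have "\<dots> \<le> sum deg W"
  proof (rule sum_mono)
    fix v
    have "deg v \<noteq> 1" unfolding deg_def by (rule card_sides_interface_neq_1)
    then show "2 * of_bool (0 < deg v) + of_bool (3 \<le> deg v) \<le> deg v" by (auto simp: of_bool_def)
  qed
  finally show ?thesis using deg_le E unfolding deg_def by linarith
qed

section \<open>Rims of rectangles and extension of labels\<close>

lemma lattice_path_line:
  assumes "i \<le> i'" and "\<And>k. i \<le> k \<Longrightarrow> k \<le> i' \<Longrightarrow> l (k, j) = c"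
  shows "(same_label l)\<^sup>*\<^sup>* (i, j) (i', j)"
  using assms
proof (induction i' rule: int_ge_induct)
  case base
  then show ?case by simp
next
  case (step k)
  have "same_label l (k, j) (k + 1, j)" using step by (simp add: same_label_def lattice_adj_def)
  then show ?case using step by (simp add: rtranclp.rtrancl_into_rtrancl)
qed

lemma lattice_path_column:
  assumes "j \<le> j'" and "\<And>k. j \<le> k \<Longrightarrow> k \<le> j' \<Longrightarrow> l (i, k) = c"
  shows "(same_label l)\<^sup>*\<^sup>* (i, j) (i, j')"
  using assms
proof (induction j' rule: int_ge_induct)
  case base
  then show ?case by simp
next
  case (step k)
  have "same_label l (i, k) (i, k + 1)" using step by (simp add: same_label_def lattice_adj_def)
  then show ?case using step by (simp add: rtranclp.rtrancl_into_rtrancl)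
qed

lemma same_label_sym: "symp (same_label l)"
  by (auto simp: symp_def same_label_def lattice_adj_sym)

lemma same_label_rtranclp_sym: "(same_label l)\<^sup>*\<^sup>* x y \<Longrightarrow> (same_label l)\<^sup>*\<^sup>* y x"
  using same_label_sym symp_rtranclp sympD by metis

lemma lattice_path_rectangle:
  assumes l: "\<And>x. x \<in> {x0..x1} \<times> {y0..y1} \<Longrightarrow> l x = c"
    and "x \<in> {x0..x1} \<times> {y0..y1}" "y \<in> {x0..x1} \<times> {y0..y1}"
  shows "(same_label l)\<^sup>*\<^sup>* x y"
proof -
  have corner: "(same_label l)\<^sup>*\<^sup>* (x0, y0) z" if "z \<in> {x0..x1} \<times> {y0..y1}" for z
  proof -
    obtain i j where z: "z = (i, j)" by (cases z)
    have "(same_label l)\<^sup>*\<^sup>* (x0, y0) (i, y0)"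
      using that l unfolding z by (intro lattice_path_line[where c = c]) auto
    also have "(same_label l)\<^sup>*\<^sup>* (i, y0) (i, j)"
      using that l unfolding z by (intro lattice_path_column[where c = c]) auto
    finally show ?thesis by (simp add: z)
  qed
  show ?thesis
    using corner[OF assms(2)] corner[OF assms(3)] same_label_rtranclp_sym rtranclp_trans by metis
qed

text \<open>The sites next to a rectangle, without the four corners, are traversed cyclically by
  \<open>rim_next\<close>; consecutive ones lie together with some site of the rectangle in the
  unit square \<open>rim_square\<close>.\<close>

locale rectangle =
  fixes x0 x1 y0 y1 :: int
  assumes le: "x0 \<le> x1" "y0 \<le> y1"
begin

definition rim :: "vtx set" where
  "rim = {x0..x1} \<times> {y0 - 1, y1 + 1} \<union> {x0 - 1, x1 + 1} \<times> {y0..y1}"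

definition rim_next :: "vtx \<Rightarrow> vtx" where
  "rim_next = (\<lambda>(i, j).
     if j = y0 - 1 then (if i < x1 then (i + 1, j) else (x1 + 1, y0))
     else if i = x1 + 1 then (if j < y1 then (i, j + 1) else (x1, y1 + 1))
     else if j = y1 + 1 then (if x0 < i then (i - 1, j) else (x0 - 1, y1))
     else (if y0 < j then (i, j - 1) else (x0, y0 - 1)))"

definition rim_square :: "vtx \<Rightarrow> vtx" where
  "rim_square = (\<lambda>(i, j).
     if j = y0 - 1 then (i, j)
     else if i = x1 + 1 then (x1, j)
     else if j = y1 + 1 then (i - 1, y1)
     else (x0 - 1, j - 1))"

lemma finite_rim: "finite rim"
  by (simp add: rim_def)

lemma rim_square_mem: "x \<in> rim \<Longrightarrow> rim_square x \<in> {x0 - 1..x1} \<times> {y0 - 1..y1}"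
  using le by (auto simp: rim_def rim_square_def)

lemma inj_on_rim_square: "inj_on rim_square rim"
  using le by (auto simp: inj_on_def rim_def rim_square_def split: if_splits)

lemma rim_next_mem: "x \<in> rim \<Longrightarrow> rim_next x \<in> rim"
  using le by (auto simp: rim_def rim_next_def split: if_splits)

text \<open>The successor walks once around: right along the bottom, up, left along the top and down
  again. Hence an invariant set reaches the left end of the bottom side, and from there every
  site.\<close>

lemma rim_next_closed:
  assumes "A \<subseteq> rim" "A \<noteq> {}" and next_mem: "\<And>x. x \<in> A \<Longrightarrow> rim_next x \<in> A"
  shows "A = rim"
proof -
  have bottom: "(i', y0 - 1) \<in> A" if "i \<le> i'" "(i, y0 - 1) \<in> A" "i' \<le> x1" for i i'
    using that
  proof (induction i' rule: int_ge_induct)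
    case (step k)
    then show ?case using next_mem[of "(k, y0 - 1)"] by (simp add: rim_next_def)
  qed
  have right: "(x1 + 1, j') \<in> A" if "j \<le> j'" "(x1 + 1, j) \<in> A" "j' \<le> y1" "y0 \<le> j" for j j'
    using that
  proof (induction j' rule: int_ge_induct)
    case (step k)
    then show ?case using next_mem[of "(x1 + 1, k)"] by (simp add: rim_next_def)
  qed
  have top: "(i', y1 + 1) \<in> A" if "i' \<le> i" "(i, y1 + 1) \<in> A" "x0 \<le> i'" "i \<le> x1" for i i'
    using that
  proof (induction i' rule: int_le_induct)
    case (step k)
    then show ?case using next_mem[of "(k, y1 + 1)"] le by (simp add: rim_next_def)
  qed
  have left: "(x0 - 1, j') \<in> A" if "j' \<le> j" "(x0 - 1, j) \<in> A" "y0 \<le> j'" "j \<le> y1" for j j'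
    using that
  proof (induction j' rule: int_le_induct)
    case (step k)
    then show ?case using next_mem[of "(x0 - 1, k)"] le by (simp add: rim_next_def)
  qed
  have br: "(x1 + 1, y0) \<in> A" if "(x1, y0 - 1) \<in> A"
    using next_mem[OF that] by (simp add: rim_next_def)
  have rt: "(x1, y1 + 1) \<in> A" if "(x1 + 1, y1) \<in> A"
    using next_mem[OF that] le by (simp add: rim_next_def)
  have tl: "(x0 - 1, y1) \<in> A" if "(x0, y1 + 1) \<in> A"
    using next_mem[OF that] le by (simp add: rim_next_def)
  have lb: "(x0, y0 - 1) \<in> A" if "(x0 - 1, y0) \<in> A"
    using next_mem[OF that] le by (simp add: rim_next_def)
  obtain i j where "(i, j) \<in> A" using \<open>A \<noteq> {}\<close> by auto
  moreover from this have "(i, j) \<in> rim" using \<open>A \<subseteq> rim\<close> by auto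
  moreover have "(x0, y0 - 1) \<in> A" if "(i, y0 - 1) \<in> A" "i \<le> x1" for i
    using lb left[of y0 y1] tl top[of x0 x1] rt right[of y0 y1] br bottom[of i x1] that le by simp
  moreover have "(x0, y0 - 1) \<in> A" if "(x1 + 1, j) \<in> A" "y0 \<le> j" "j \<le> y1"
    using lb left[of y0 y1] tl top[of x0 x1] rt right[of j y1] that le by simp
  moreover have "(x0, y0 - 1) \<in> A" if "(i, y1 + 1) \<in> A" "x0 \<le> i" "i \<le> x1"
    using lb left[of y0 y1] tl top[of x0 i] that le by simp
  moreover have "(x0, y0 - 1) \<in> A" if "(x0 - 1, j) \<in> A" "y0 \<le> j" "j \<le> y1"
    using lb left[of y0 j] that le by simp
  ultimately have start: "(x0, y0 - 1) \<in> A" by (auto simp: rim_def)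
  have "rim \<subseteq> A"
  proof
    fix x assume "x \<in> rim"
    then obtain i j where x: "x = (i, j)" "(i, j) \<in> rim" by (cases x) auto
    have b: "(x1, y0 - 1) \<in> A" using bottom[OF _ start] le by simp
    have r: "(x1 + 1, y1) \<in> A" using right[OF _ br[OF b]] le by simp
    have t: "(x0, y1 + 1) \<in> A" using top[OF _ rt[OF r]] le by simp
    show "x \<in> A"
      using x bottom[OF _ start, of i] right[OF _ br[OF b], of j] top[OF _ rt[OF r], of i]
        left[OF _ tl[OF t], of j] by (auto simp: rim_def)
  qed
  then show ?thesis using \<open>A \<subseteq> rim\<close> by auto
qed

text \<open>On a cycle with at least two labels every label class is left somewhere, and different
  labels are left at different sites.\<close>

lemma card_labels_le_changes:
  assumes "1 < card (l ` rim)"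
  shows "card (l ` rim) \<le> card {x \<in> rim. l x \<noteq> l (rim_next x)}"
proof -
  have "a \<in> l ` {x \<in> rim. l x \<noteq> l (rim_next x)}" if "a \<in> l ` rim" for a
  proof (rule ccontr)
    assume no: "a \<notin> l ` {x \<in> rim. l x \<noteq> l (rim_next x)}"
    have "{x \<in> rim. l x = a} = rim"
    proof (rule rim_next_closed)
      show "{x \<in> rim. l x = a} \<noteq> {}" using that by auto
      show "rim_next x \<in> {x \<in> rim. l x = a}" if "x \<in> {x \<in> rim. l x = a}" for x
        using that no rim_next_mem by (metis (mono_tags, lifting) image_eqI mem_Collect_eq)
    qed simp
    then have "l ` rim \<subseteq> {a}" by auto
    then have "card (l ` rim) \<le> card {a}" by (intro card_mono) auto
    then show False using assms by simp
  qed
  then have "l ` rim \<subseteq> l ` {x \<in> rim. l x \<noteq> l (rim_next x)}" by blast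
  then have "card (l ` rim) \<le> card (l ` {x \<in> rim. l x \<noteq> l (rim_next x)})"
    using finite_rim by (intro card_mono) auto
  also have "\<dots> \<le> card {x \<in> rim. l x \<noteq> l (rim_next x)}"
    using finite_rim by (intro card_image_le) auto
  finally show ?thesis .
qed

text \<open>Along a side the corners of the square have labels \<open>l x\<close>,
  \<open>l (rim_next x)\<close>, \<open>c\<close>, \<open>c\<close>. At a corner of the rectangle
  one \<open>c\<close> is replaced by an unknown label, which differs from at least one of the two
  distinct rim labels. In both cases at least three sides separate labels.\<close>

lemma branching_rim_square:
  assumes inner: "\<And>x. x \<in> {x0..x1} \<times> {y0..y1} \<Longrightarrow> l x = c"
    and outer: "\<And>x. x \<in> rim \<Longrightarrow> l x \<noteq> c"
    and "x \<in> rim" and change: "l x \<noteq> l (rim_next x)"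
  shows "3 \<le> card (sides (rim_square x) \<inter> interface l)"
proof -
  obtain i j where x: "x = (i, j)" by (cases x)
  have out: "l (k, y0 - 1) \<noteq> c" "l (k, y1 + 1) \<noteq> c" if "x0 \<le> k" "k \<le> x1" for k
    using that outer by (auto simp: rim_def)
  have out': "l (x0 - 1, k) \<noteq> c" "l (x1 + 1, k) \<noteq> c" if "y0 \<le> k" "k \<le> y1" for k
    using that outer by (auto simp: rim_def)
  have inn: "l (k, m) = c" if "x0 \<le> k" "k \<le> x1" "y0 \<le> m" "m \<le> y1" for k m
    using that inner by auto
  have "(x0 \<le> i \<and> i \<le> x1 \<and> (j = y0 - 1 \<or> j = y1 + 1)) \<or>
      ((i = x0 - 1 \<or> i = x1 + 1) \<and> y0 \<le> j \<and> j \<le> y1)"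
    using \<open>x \<in> rim\<close> by (auto simp: x rim_def)
  then consider "x0 \<le> i" "i \<le> x1" "j = y0 - 1" | "y0 \<le> j" "j \<le> y1" "i = x1 + 1"
    | "x0 \<le> i" "i \<le> x1" "j = y1 + 1" | "y0 \<le> j" "j \<le> y1" "i = x0 - 1"
    by blast
  then show ?thesis
  proof cases
    case 1
    show ?thesis
    proof (cases "i = x1")
      case True
      then show ?thesis using change 1 out[of i] out'[of y0] inn[of i y0] le
        by (auto simp: x rim_next_def rim_square_def card_sides_Int of_bool_def)
    next
      case False
      then show ?thesis using change 1 out[of i] out[of "i + 1"] inn[of i y0] inn[of "i + 1" y0] le
        by (simp add: x rim_next_def rim_square_def card_sides_Int)
    qed
  next
    case 2
    show ?thesis
    proof (cases "j = y1")
      case True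
      then show ?thesis using change 2 out[of x1] out'[of y1] inn[of x1 y1] le
        by (auto simp: x rim_next_def rim_square_def card_sides_Int of_bool_def)
    next
      case False
      then show ?thesis using change 2 out'[of j] out'[of "j + 1"] inn[of x1 j] inn[of x1 "j + 1"] le
        by (simp add: x rim_next_def rim_square_def card_sides_Int)
    qed
  next
    case 3
    show ?thesis
    proof (cases "i = x0")
      case True
      then show ?thesis using change 3 out[of x0] out'[of y1] inn[of x0 y1] le
        by (auto simp: x rim_next_def rim_square_def card_sides_Int of_bool_def)
    next
      case False
      then show ?thesis using change 3 out[of i] out[of "i - 1"] inn[of i y1] inn[of "i - 1" y1] le
        by (simp add: x rim_next_def rim_square_def card_sides_Int)
    qed
  next
    case 4
    show ?thesis
    proof (cases "j = y0")
      case True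
      then show ?thesis using change 4 out[of x0] out'[of y0] inn[of x0 y0] le
        by (auto simp: x rim_next_def rim_square_def card_sides_Int of_bool_def)
    next
      case False
      then show ?thesis using change 4 out'[of j] out'[of "j - 1"] inn[of x0 j] inn[of x0 "j - 1"] le
        by (simp add: x rim_next_def rim_square_def card_sides_Int)
    qed
  qed
qed

text \<open>\<open>rim_square\<close> is injective, so the label changes along the rim give as many
  different branching squares.\<close>

lemma three_branching_squares:
  assumes inner: "\<And>x. x \<in> {x0..x1} \<times> {y0..y1} \<Longrightarrow> l x = c"
    and outer: "\<And>x. x \<in> rim \<Longrightarrow> l x \<noteq> c"
    and three: "3 \<le> card (l ` rim)"
  shows "3 \<le> card {v \<in> {x0 - 1..x1} \<times> {y0 - 1..y1}. 3 \<le> card (sides v \<inter> interface l)}"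
proof -
  let ?C = "{x \<in> rim. l x \<noteq> l (rim_next x)}"
  have "3 \<le> card ?C" using card_labels_le_changes[of l] three by linarith
  also have "card ?C = card (rim_square ` ?C)"
    using inj_on_subset[OF inj_on_rim_square, of ?C] by (simp add: card_image)
  also have "\<dots> \<le> card {v \<in> {x0 - 1..x1} \<times> {y0 - 1..y1}. 3 \<le> card (sides v \<inter> interface l)}"
  proof (intro card_mono subsetI)
    fix v assume "v \<in> rim_square ` ?C"
    then obtain x where "v = rim_square x" "x \<in> rim" "l x \<noteq> l (rim_next x)" by blast
    then show "v \<in> {v \<in> {x0 - 1..x1} \<times> {y0 - 1..y1}. 3 \<le> card (sides v \<inter> interface l)}"
      using rim_square_mem branching_rim_square[of l c x] inner outer by blast
  qed simp
  finally show ?thesis .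
qed

text \<open>The set \<open>S\<close> also contains the four diagonal corners missing from
  \<open>rim\<close>, so turning a corner takes two lattice steps inside \<open>S\<close>.\<close>

lemma rim_connected:
  assumes S: "S = {x0 - 1..x1 + 1} \<times> {y0 - 1..y1 + 1} - {x0..x1} \<times> {y0..y1}"
    and "x \<in> rim" "y \<in> rim"
  shows "(\<lambda>x y. lattice_adj x y \<and> x \<in> S \<and> y \<in> S)\<^sup>*\<^sup>* x y" (is "?R\<^sup>*\<^sup>* x y")
proof -
  have two: "?R\<^sup>*\<^sup>* u w" if "?R u v" "?R v w" for u v w
    by (rule rtranclp_trans[OF r_into_rtranclp[of ?R, OF that(1)] r_into_rtranclp[of ?R, OF that(2)]])
  have step: "?R\<^sup>*\<^sup>* u (rim_next u)" if u: "u \<in> rim" for u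
  proof -
    obtain i j where ij: "u = (i, j)" by (cases u)
    have "(x0 \<le> i \<and> i \<le> x1 \<and> (j = y0 - 1 \<or> j = y1 + 1)) \<or>
        ((i = x0 - 1 \<or> i = x1 + 1) \<and> y0 \<le> j \<and> j \<le> y1)"
      using u by (auto simp: ij rim_def)
    then consider "x0 \<le> i" "i \<le> x1" "j = y0 - 1" | "y0 \<le> j" "j \<le> y1" "i = x1 + 1"
      | "x0 \<le> i" "i \<le> x1" "j = y1 + 1" | "y0 \<le> j" "j \<le> y1" "i = x0 - 1"
      by blast
    then show ?thesis
    proof cases
      case 1
      show ?thesis
      proof (cases "i = x1")
        case True
        then show ?thesis using 1 le
          by (intro two[of _ "(x1 + 1, y0 - 1)"]) (auto simp: ij rim_next_def lattice_adj_def S)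
      next
        case False
        then show ?thesis using 1 le
          by (intro r_into_rtranclp) (auto simp: ij rim_next_def lattice_adj_def S)
      qed
    next
      case 2
      show ?thesis
      proof (cases "j = y1")
        case True
        then show ?thesis using 2 le
          by (intro two[of _ "(x1 + 1, y1 + 1)"]) (auto simp: ij rim_next_def lattice_adj_def S)
      next
        case False
        then show ?thesis using 2 le
          by (intro r_into_rtranclp) (auto simp: ij rim_next_def lattice_adj_def S)
      qed
    next
      case 3
      show ?thesis
      proof (cases "i = x0")
        case True
        then show ?thesis using 3 le
          by (intro two[of _ "(x0 - 1, y1 + 1)"]) (auto simp: ij rim_next_def lattice_adj_def S)
      next
        case False
        then show ?thesis using 3 le
          by (intro r_into_rtranclp) (auto simp: ij rim_next_def lattice_adj_def S)
      qed
    next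
      case 4
      show ?thesis
      proof (cases "j = y0")
        case True
        then show ?thesis using 4 le
          by (intro two[of _ "(x0 - 1, y0 - 1)"]) (auto simp: ij rim_next_def lattice_adj_def S)
      next
        case False
        then show ?thesis using 4 le
          by (intro r_into_rtranclp) (auto simp: ij rim_next_def lattice_adj_def S)
      qed
    qed
  qed
  have "{y \<in> rim. ?R\<^sup>*\<^sup>* x y} = rim"
  proof (rule rim_next_closed)
    show "{y \<in> rim. ?R\<^sup>*\<^sup>* x y} \<noteq> {}" using \<open>x \<in> rim\<close> by blast
    show "rim_next u \<in> {y \<in> rim. ?R\<^sup>*\<^sup>* x y}" if "u \<in> {y \<in> rim. ?R\<^sup>*\<^sup>* x y}" for u
      using that step[of u] rim_next_mem[of u] rtranclp_trans[of ?R x u] by blast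
  qed simp
  then show ?thesis using \<open>y \<in> rim\<close> by blast
qed

lemma rim_subset: "rim \<subseteq> {x0 - 1..x1 + 1} \<times> {y0 - 1..y1 + 1} - {x0..x1} \<times> {y0..y1}"
  using le by (auto simp: rim_def)

lemma mem_rim:
  assumes "x \<in> {x0..x1} \<times> {y0..y1}" "lattice_adj x y" "y \<notin> {x0..x1} \<times> {y0..y1}"
  shows "y \<in> rim"
  using assms(2,1,3) by (cases rule: lattice_adj_cases; cases x; cases y) (auto simp: rim_def)

end

text \<open>Every site of \<open>W\<close> inherits the label at the end of a shortest
  \<open>R\<close>-path to \<open>U\<close>, built by moving repeatedly to a chosen site that is one
  step closer. All sites on this path get the same label, as their own chosen paths are tails of
  it.\<close>

lemma extend_labels:
  fixes R :: "'a \<Rightarrow> 'a \<Rightarrow> bool" and l0 :: "'a \<Rightarrow> 'l"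
  assumes reach: "\<And>w. w \<in> W \<Longrightarrow> \<exists>u\<in>U. R\<^sup>*\<^sup>* w u"
  obtains l where "\<And>u. u \<in> U \<Longrightarrow> l u = l0 u"
    and "\<And>w. w \<in> W \<Longrightarrow> \<exists>u\<in>U. (\<lambda>x y. R x y \<and> l x = l y)\<^sup>*\<^sup>* w u"
proof -
  define hits where "hits n w \<longleftrightarrow> (\<exists>u\<in>U. (R ^^ n) w u)" for n w
  define d where "d w = (LEAST n. hits n w)" for w
  define closer where "closer w = (SOME v. R w v \<and> hits (d w - 1) v \<and> d v = d w - 1)" for w
  define l where "l w = l0 ((closer ^^ d w) w)" for w
  have closer: "R w (closer w) \<and> hits n (closer w) \<and> d (closer w) = n"
    if w: "hits (Suc n) w" "d w = Suc n" for n w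
  proof -
    obtain u v where "u \<in> U" "R w v" "(R ^^ n) v u"
      using w(1) unfolding hits_def by (blast dest: relpowp_Suc_D2)
    then have v: "hits n v" by (auto simp: hits_def)
    have "d v = n"
    proof (rule ccontr)
      assume "d v \<noteq> n"
      then have "d v < n" using v by (simp add: d_def Least_le order_neq_le_trans)
      have "hits (d v) v" using v unfolding d_def by (rule LeastI)
      then have "hits (Suc (d v)) w" using \<open>R w v\<close> unfolding hits_def by (blast intro: relpowp_Suc_I2)
      then have "d w \<le> Suc (d v)" unfolding d_def by (rule Least_le)
      then show False using that \<open>d v < n\<close> by simp
    qed
    then have "\<exists>v. R w v \<and> hits (d w - 1) v \<and> d v = d w - 1"
      using \<open>R w v\<close> v that(2) by (intro exI[of _ v]) simp
    from someI_ex[OF this] show ?thesis unfolding closer_def[symmetric] by (simp add: w(2))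
  qed
  have path: "\<exists>u\<in>U. (\<lambda>x y. R x y \<and> l x = l y)\<^sup>*\<^sup>* w u" if "hits n w" "d w = n" for n w
    using that
  proof (induction n arbitrary: w)
    case 0
    then show ?case by (auto simp: hits_def)
  next
    case (Suc n)
    note c = closer[OF Suc.prems]
    have "l w = l (closer w)" using c Suc.prems by (simp add: l_def funpow_swap1)
    then have "R w (closer w) \<and> l w = l (closer w)" using c by simp
    moreover obtain u where "u \<in> U" "(\<lambda>x y. R x y \<and> l x = l y)\<^sup>*\<^sup>* (closer w) u"
      using Suc.IH[of "closer w"] c by blast
    ultimately show ?case by (intro bexI[of _ u] converse_rtranclp_into_rtranclp[of _ w "closer w"])
  qed
  show ?thesis
  proof
    fix u assume "u \<in> U"
    then have "hits 0 u" by (auto simp: hits_def)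
    then have "d u = 0" by (simp add: d_def)
    then show "l u = l0 u" by (simp add: l_def)
  next
    fix w assume "w \<in> W"
    then obtain n where "hits n w" using reach unfolding hits_def rtranclp_power by blast
    then have "hits (d w) w" unfolding d_def by (rule LeastI)
    then show "\<exists>u\<in>U. (\<lambda>x y. R x y \<and> l x = l y)\<^sup>*\<^sup>* w u" using path by blast
  qed
qed

section \<open>Encounter blocks of a flow on the lattice\<close>

definition block :: "int \<Rightarrow> vtx \<Rightarrow> vtx set" where
  "block r z = {fst z - r..fst z + r} \<times> {snd z - r..snd z + r}"

lemma mem_block: "x \<in> block r z \<longleftrightarrow> \<bar>fst x - fst z\<bar> \<le> r \<and> \<bar>snd x - snd z\<bar> \<le> r"
  by (cases x) (auto simp: block_def)

lemma finite_block [simp]: "finite (block r z)"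
  by (simp add: block_def)

lemma lattice_connected: "lattice_adj\<^sup>*\<^sup>* x y"
proof -
  \<comment> \<open>A constant label turns label paths into lattice paths, here inside the smallest
    rectangle containing both sites.\<close>
  have "(same_label (\<lambda>_. ()))\<^sup>*\<^sup>* x y"
    by (rule lattice_path_rectangle[where ?x0.0 = "min (fst x) (fst y)" and ?x1.0 = "max (fst x) (fst y)"
        and ?y0.0 = "min (snd x) (snd y)" and ?y1.0 = "max (snd x) (snd y)" and c = "()"])
      (auto simp: mem_Times_iff)
  then show ?thesis by (rule rtranclp_mono[THEN predicate2D, rotated]) (auto simp: same_label_def)
qed

text \<open>The second half of the condition bounds the backward cluster of each site of the block. It is
  what keeps the orbits leaving one encounter block away from all the others.\<close>

definition encounter :: "(vtx \<Rightarrow> vtx) \<Rightarrow> (vtx \<Rightarrow> 'c) \<Rightarrow> int \<Rightarrow> int \<Rightarrow> vtx \<Rightarrow> bool" where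
  "encounter F cls r K z \<longleftrightarrow>
     (\<exists>X \<subseteq> block r z. 3 \<le> card (cls ` X) \<and> (\<forall>x\<in>X. inj (\<lambda>n. (F ^^ n) x))) \<and>
     (\<forall>x n. (F ^^ n) x \<in> block r z \<longrightarrow> x \<in> block K ((F ^^ n) x))"

text \<open>The deterministic part of the argument; it is applied with \<open>F\<close> the step to
  the nearest neighbour and \<open>cls\<close> the component.\<close>

locale lattice_flow =
  fixes F :: "vtx \<Rightarrow> vtx" and cls :: "vtx \<Rightarrow> 'c"
  assumes adj: "lattice_adj x (F x)" and cls: "cls (F x) = cls x"
begin

lemma cls_funpow: "cls ((F ^^ n) x) = cls x"
  by (induction n) (auto simp: cls)

text \<open>Every encounter block forces three branching squares of its own, while
  \<open>card_branching_le\<close> allows only two for each block and a boundary term. The excess of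
  one for each block is thus bounded by the boundary, which is linear in \<open>m\<close>.\<close>

lemma card_encounters_le:
  fixes r K :: int and m :: nat
  assumes "0 \<le> r" "0 \<le> K" and L: "L = K + 2 * r + 2"
    and J: "J \<subseteq> (\<lambda>(a, b). (L * int a, L * int b)) ` ({..<m} \<times> {..<m})"
    and enc: "\<And>z. z \<in> J \<Longrightarrow> encounter F cls r K z"
  shows "card J \<le> 8 * nat (L * int m + 2 * r + 2) + 8"
proof (cases "J = {}")
  case False
  have finJ: "finite J" using J finite_subset by fastforce
  have grid: "\<exists>a b. z = (L * int a, L * int b) \<and> a < m \<and> b < m" if "z \<in> J" for z
    using subsetD[OF J that] by auto
  have apart: "L \<le> \<bar>fst z - fst z'\<bar> \<or> L \<le> \<bar>snd z - snd z'\<bar>" if zz: "z \<in> J" "z' \<in> J" "z \<noteq> z'" for z z'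
  proof -
    have far: "L \<le> \<bar>L * int a - L * int b\<bar>" if "a \<noteq> b" for a b
    proof -
      have "L * 1 \<le> L * \<bar>int a - int b\<bar>"
        using that assms by (intro mult_left_mono) auto
      also have "\<dots> = \<bar>L * int a - L * int b\<bar>"
        using assms by (simp add: abs_mult right_diff_distrib[symmetric])
      finally show ?thesis by simp
    qed
    obtain a b where "z = (L * int a, L * int b)" using grid[OF zz(1)] by blast
    moreover obtain a' b' where "z' = (L * int a', L * int b')" using grid[OF zz(2)] by blast
    ultimately show ?thesis using far[of a a'] far[of b b'] zz by auto
  qed
  \<comment> \<open>\<open>L\<close> exceeds \<open>(r + 1) + K + r\<close> by one, so no site in or
    next to one block lies within \<open>K\<close> of a site of another.\<close>
  have sep: False if "z \<in> J" "z' \<in> J" "z \<noteq> z'" "x \<in> block (r + 1) z" "y \<in> block r z'" "x \<in> block K y" for z z' x y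
    using apart[OF that(1-3)] that(4-6) unfolding mem_block L by linarith
  have sep1: False if "z \<in> J" "z' \<in> J" "z \<noteq> z'" "x \<in> block (r + 1) z" "x \<in> block r z'" for z z' x
    using sep[OF that] \<open>0 \<le> K\<close> by (simp add: mem_block)
  define blocks where "blocks = (\<Union>z\<in>J. block r z)"
  define W where "W = - blocks"
  \<comment> \<open>\<open>U\<close> carries the infinite flow lines that stay outside all
    blocks.\<close>
  define U where "U = {x. inj (\<lambda>n. (F ^^ n) x) \<and> (\<forall>n. (F ^^ n) x \<in> W)}"
  define R where "R x y \<longleftrightarrow> lattice_adj x y \<and> x \<in> W \<and> y \<in> W" for x y
  define rim where "rim z = rectangle.rim (fst z - r) (fst z + r) (snd z - r) (snd z + r)" for z
  have rect: "rectangle (fst z - r) (fst z + r) (snd z - r) (snd z + r)" for z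
    using \<open>0 \<le> r\<close> by unfold_locales auto
  have U_W: "x \<in> W" if "x \<in> U" for x
    using that funpow_0 unfolding U_def by (metis (mono_tags, lifting) mem_Collect_eq)
  have U_F: "(F ^^ n) x \<in> U" if "x \<in> U" for x n
  proof -
    have "inj (\<lambda>k. (F ^^ (k + n)) x)"
      using that inj_compose[of "\<lambda>n. (F ^^ n) x" "\<lambda>k. k + n"] by (simp add: U_def comp_def)
    moreover have "(F ^^ k) ((F ^^ n) x) = (F ^^ (k + n)) x" for k by (simp add: funpow_add)
    ultimately show ?thesis using that by (simp add: U_def)
  qed
  have shell: "{fst z - r - 1..fst z + r + 1} \<times> {snd z - r - 1..snd z + r + 1}
      - {fst z - r..fst z + r} \<times> {snd z - r..snd z + r} \<subseteq> W" (is "?S z \<subseteq> W") if "z \<in> J" for z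
  proof
    fix x assume "x \<in> ?S z"
    then have "x \<in> block (r + 1) z" "x \<notin> block r z" by (auto simp: block_def)
    then show "x \<in> W" using sep1[OF that] unfolding W_def blocks_def by blast
  qed
  have rim_W: "rim z \<subseteq> W" if "z \<in> J" for z
    using rectangle.rim_subset[OF rect[of z]] shell[OF that] unfolding rim_def by blast
  \<comment> \<open>Take the last visit of the orbit to the block; the next site \<open>u\<close> is
    on the rim. If its orbit entered another block, the last visited site would be in the backward
    cluster of a site there, which is too far away.\<close>
  have exit: "\<exists>u\<in>rim z \<inter> U. cls u = cls x"
    if z: "z \<in> J" "x \<in> block r z" "inj (\<lambda>n. (F ^^ n) x)" for x z
  proof -
    define A where "A = {n. (F ^^ n) x \<in> block r z}"
    have "finite A" using finite_vimageI[OF finite_block z(3)] by (simp add: A_def vimage_def)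
    have "0 \<in> A" using z by (simp add: A_def)
    define k where "k = Max A"
    have "k \<in> A" unfolding k_def using \<open>finite A\<close> \<open>0 \<in> A\<close> by (intro Max_in) auto
    have later: "(F ^^ n) x \<notin> block r z" if "k < n" for n
      using that \<open>finite A\<close> Max_ge unfolding A_def k_def by fastforce
    define u where "u = (F ^^ Suc k) x"
    have u_pow: "(F ^^ n) u = (F ^^ Suc n) ((F ^^ k) x)" "(F ^^ n) u = (F ^^ (Suc k + n)) x" for n
      by (simp_all add: u_def funpow_add funpow_swap1 add.commute[of k])
    have "(F ^^ n) u \<in> W" for n
    proof (rule ccontr)
      assume "(F ^^ n) u \<notin> W"
      then obtain z' where z': "z' \<in> J" "(F ^^ n) u \<in> block r z'" by (auto simp: W_def blocks_def)
      have "z \<noteq> z'" using later[of "Suc k + n"] z' u_pow(2)[of n] by auto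
      have "(F ^^ k) x \<in> block K ((F ^^ n) u)"
        using enc[OF z'(1)] z'(2) unfolding encounter_def u_pow(1) by blast
      moreover have "(F ^^ k) x \<in> block (r + 1) z"
        using \<open>k \<in> A\<close> unfolding A_def mem_block by simp
      ultimately show False using sep[OF z(1) z'(1) \<open>z \<noteq> z'\<close> _ z'(2)] by blast
    qed
    moreover have "inj (\<lambda>n. (F ^^ n) u)"
      using inj_compose[OF z(3), of "\<lambda>n. Suc k + n"] unfolding u_pow(2) by (auto simp: comp_def inj_on_def)
    ultimately have "u \<in> U" by (simp add: U_def)
    moreover have "u \<in> rim z"
      unfolding rim_def
    proof (rule rectangle.mem_rim[OF rect])
      show "(F ^^ k) x \<in> {fst z - r..fst z + r} \<times> {snd z - r..snd z + r}"
        using \<open>k \<in> A\<close> by (simp add: A_def block_def)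
      show "lattice_adj ((F ^^ k) x) u" using adj by (simp add: u_def)
      show "u \<notin> {fst z - r..fst z + r} \<times> {snd z - r..snd z + r}"
        using later[of "Suc k"] by (simp add: u_def block_def)
    qed
    ultimately show ?thesis using cls_funpow[of "Suc k" x] u_def by blast
  qed
  have three: "\<exists>Y \<subseteq> rim z \<inter> U. 3 \<le> card (cls ` Y)" if z: "z \<in> J" for z
  proof -
    obtain X where X: "X \<subseteq> block r z" "3 \<le> card (cls ` X)" "\<forall>x\<in>X. inj (\<lambda>n. (F ^^ n) x)"
      using enc[OF z] unfolding encounter_def by blast
    have "cls ` X \<subseteq> cls ` (rim z \<inter> U)"
    proof (rule image_subsetI)
      fix x assume "x \<in> X"
      then obtain u where "u \<in> rim z \<inter> U" "cls u = cls x" using exit[OF z] X by blast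
      then show "cls x \<in> cls ` (rim z \<inter> U)" by (metis imageI)
    qed
    moreover have "finite (rim z)" unfolding rim_def by (rule rectangle.finite_rim[OF rect])
    ultimately have "card (cls ` X) \<le> card (cls ` (rim z \<inter> U))" by (intro card_mono) auto
    then show ?thesis using X by (intro exI[of _ "rim z \<inter> U"]) auto
  qed
  have reach: "\<exists>u\<in>U. R\<^sup>*\<^sup>* w u" if "w \<in> W" for w
  proof -
    obtain z0 where "z0 \<in> J" using False by auto
    then obtain Y where "Y \<subseteq> U" "3 \<le> card (cls ` Y)" using three[of z0] by auto
    then have "Y \<noteq> {}" by auto
    then obtain u0 where "u0 \<in> U" using \<open>Y \<subseteq> U\<close> by auto
    \<comment> \<open>Induction along a lattice path to \<open>u0\<close>, from its end: where the
      path steps into a block, the site before it is on the rim and can be joined around the block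
      to a rim site in \<open>U\<close>.\<close>
    have "w \<in> W \<longrightarrow> (\<exists>u\<in>U. R\<^sup>*\<^sup>* w u)"
      using lattice_connected[of w u0]
    proof (induction rule: converse_rtranclp_induct)
      case base
      then show ?case using \<open>u0 \<in> U\<close> by blast
    next
      case (step w v)
      show ?case
      proof
        assume "w \<in> W"
        show "\<exists>u\<in>U. R\<^sup>*\<^sup>* w u"
        proof (cases "v \<in> W")
          case True
          then have "R w v" using step \<open>w \<in> W\<close> by (simp add: R_def)
          then show ?thesis using step.IH True by (meson converse_rtranclp_into_rtranclp)
        next
          case False
          then obtain z where z: "z \<in> J" "v \<in> block r z" by (auto simp: W_def blocks_def)
          then have "w \<in> rim z"
            unfolding rim_def using \<open>w \<in> W\<close> step.hyps(1)
            by (intro rectangle.mem_rim[OF rect, of v])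
              (auto simp: lattice_adj_sym block_def W_def blocks_def)
          obtain Y where "Y \<subseteq> rim z \<inter> U" "3 \<le> card (cls ` Y)" using three[OF z(1)] by blast
          then have "Y \<noteq> {}" by auto
          then obtain u where u: "u \<in> rim z" "u \<in> U" using \<open>Y \<subseteq> rim z \<inter> U\<close> by auto
          have "(\<lambda>x y. lattice_adj x y \<and> x \<in> ?S z \<and> y \<in> ?S z)\<^sup>*\<^sup>* w u"
            by (rule rectangle.rim_connected[OF rect refl])
              (use \<open>w \<in> rim z\<close> u in \<open>simp_all add: rim_def\<close>)
          then have "R\<^sup>*\<^sup>* w u"
            by (rule rtranclp_mono[THEN predicate2D, rotated])
              (intro predicate2I, unfold R_def, use shell[OF z(1)] in blast)
          then show ?thesis using u by blast
        qed
      qed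
    qed
    then show ?thesis using that by blast
  qed
  obtain l where l_U: "\<And>u. u \<in> U \<Longrightarrow> l u = cls u"
    and l_W: "\<And>w. w \<in> W \<Longrightarrow> \<exists>u\<in>U. (\<lambda>x y. R x y \<and> l x = l y)\<^sup>*\<^sup>* w u"
    using extend_labels[OF reach, where ?l0.0 = cls] by blast
  \<comment> \<open>The sum type keeps block labels apart from component labels, and each block gets
    a label of its own.\<close>
  define lab :: "vtx \<Rightarrow> vtx + 'c" where
    "lab x = (if x \<in> W then Inr (l x) else Inl (SOME z. z \<in> J \<and> x \<in> block r z))" for x
  have lab_block: "lab x = Inl z" if "z \<in> J" "x \<in> block r z" for x z
  proof -
    have "(SOME z. z \<in> J \<and> x \<in> block r z) = z"
    proof (rule some_equality)
      show "z' = z" if "z' \<in> J \<and> x \<in> block r z'" for z'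
      proof (rule ccontr)
        assume "z' \<noteq> z"
        moreover have "x \<in> block (r + 1) z'" using that unfolding mem_block by simp
        ultimately show False using sep1[of z' z x] that \<open>z \<in> J\<close> \<open>x \<in> block r z\<close> by blast
      qed
    qed (use that in blast)
    moreover have "x \<notin> W" using that by (auto simp: W_def blocks_def)
    ultimately show ?thesis by (simp add: lab_def)
  qed
  \<comment> \<open>A site of \<open>W\<close> is linked to a site of \<open>U\<close>, whose
    infinite orbit carries a constant component label; a site of a block is linked to its centre,
    which is in \<open>J\<close>.\<close>
  have reg: "infinite {y. (same_label lab)\<^sup>*\<^sup>* x y} \<or> (\<exists>b\<in>J. (same_label lab)\<^sup>*\<^sup>* x b)" for x
  proof (cases "x \<in> W")
    case True
    then obtain u where "u \<in> U" and path: "(\<lambda>x y. R x y \<and> l x = l y)\<^sup>*\<^sup>* x u" using l_W by blast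
    have xu: "(same_label lab)\<^sup>*\<^sup>* x u"
      by (rule rtranclp_mono[THEN predicate2D, OF _ path]) (auto simp: R_def same_label_def lab_def)
    have "(same_label lab)\<^sup>*\<^sup>* x ((F ^^ n) u)" for n
    proof (induction n)
      case (Suc n)
      have "(F ^^ n) u \<in> U" "(F ^^ Suc n) u \<in> U" using U_F[OF \<open>u \<in> U\<close>] by blast+
      then have "same_label lab ((F ^^ n) u) ((F ^^ Suc n) u)"
        using U_W l_U adj by (simp add: same_label_def lab_def cls)
      with Suc show ?case by (rule rtranclp.rtrancl_into_rtrancl)
    qed (use xu in simp)
    then have "range (\<lambda>n. (F ^^ n) u) \<subseteq> {y. (same_label lab)\<^sup>*\<^sup>* x y}" by auto
    moreover have "infinite (range (\<lambda>n. (F ^^ n) u))"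
      using \<open>u \<in> U\<close> finite_imageD unfolding U_def by fastforce
    ultimately show ?thesis using finite_subset by blast
  next
    case False
    then obtain z where z: "z \<in> J" "x \<in> block r z" by (auto simp: W_def blocks_def)
    have "(same_label lab)\<^sup>*\<^sup>* x z"
      by (rule lattice_path_rectangle[where c = "Inl z"])
        (use z lab_block \<open>0 \<le> r\<close> in \<open>auto simp: block_def mem_Times_iff\<close>)
    then show ?thesis using z by blast
  qed
  \<comment> \<open>The window starts at \<open>- r - 1\<close>, the least possible lower left
    coordinate of a square meeting a block, and this length makes it contain all such
    squares.\<close>
  define N where "N = nat (L * int m + 2 * r + 2)"
  define Win where "Win = {- r - 1..<- r - 1 + int N} \<times> {- r - 1..<- r - 1 + int N}"
  define Q where "Q z = {v \<in> {fst z - r - 1..fst z + r} \<times> {snd z - r - 1..snd z + r}.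
      3 \<le> card (sides v \<inter> interface lab)}" for z
  have Q3: "3 \<le> card (Q z)" if z: "z \<in> J" for z
    unfolding Q_def
  proof (rule rectangle.three_branching_squares[OF rect])
    show "lab x = Inl z" if "x \<in> {fst z - r..fst z + r} \<times> {snd z - r..snd z + r}" for x
      using lab_block[OF \<open>z \<in> J\<close>] that by (simp add: block_def)
    fix x assume "x \<in> rectangle.rim (fst z - r) (fst z + r) (snd z - r) (snd z + r)"
    then show "lab x \<noteq> Inl z" using rim_W[OF that] by (auto simp: lab_def rim_def)
  next
    obtain Y where Y: "Y \<subseteq> rim z \<inter> U" "3 \<le> card (cls ` Y)" using three[OF z] by blast
    have "Inr ` cls ` Y \<subseteq> lab ` rim z"
      using Y(1) l_U U_W by (force simp: lab_def)
    moreover have "finite (rim z)" unfolding rim_def by (rule rectangle.finite_rim[OF rect])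
    ultimately have "card (Inr ` cls ` Y :: (vtx + 'c) set) \<le> card (lab ` rim z)" by (intro card_mono) auto
    then show "3 \<le> card (lab ` rectangle.rim (fst z - r) (fst z + r) (snd z - r) (snd z + r))"
      using Y(2) by (simp add: card_image rim_def)
  qed
  have "3 * card J \<le> (\<Sum>z\<in>J. card (Q z))"
    using sum_mono[of J "\<lambda>_. 3" "\<lambda>z. card (Q z)"] Q3 by simp
  \<comment> \<open>The squares of \<open>Q z\<close> occupy \<open>2 * r + 2\<close> rows and
    columns, at most \<open>L\<close>, so the sets for different grid points are disjoint.\<close>
  also have "\<dots> = card (\<Union>z\<in>J. Q z)"
  proof (rule card_UN_disjoint[symmetric])
    show "\<forall>z\<in>J. \<forall>z'\<in>J. z \<noteq> z' \<longrightarrow> Q z \<inter> Q z' = {}"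
    proof (intro ballI impI equals0I)
      fix z z' v assume zz: "z \<in> J" "z' \<in> J" "z \<noteq> z'" and "v \<in> Q z \<inter> Q z'"
      then show False using apart[OF zz] \<open>0 \<le> K\<close> \<open>0 \<le> r\<close> L unfolding Q_def by auto
    qed
  qed (use finJ in \<open>auto simp: Q_def\<close>)
  also have "\<dots> \<le> card {v \<in> Win. 3 \<le> card (sides v \<inter> interface lab)}"
  proof (intro card_mono)
    have "{fst z - r - 1..fst z + r} \<times> {snd z - r - 1..snd z + r} \<subseteq> Win" if z: "z \<in> J" for z
    proof -
      have bound: "0 \<le> L * int a \<and> L * int a + L \<le> L * int m" if "a < m" for a
      proof -
        have "L * (int a + 1) \<le> L * int m" using that assms by (intro mult_left_mono) auto
        then show ?thesis using assms by (simp add: distrib_left)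
      qed
      obtain a b where "z = (L * int a, L * int b)" "a < m" "b < m" using grid[OF z] by blast
      then obtain p q where "z = (p, q)" "0 \<le> p" "p + L \<le> L * int m" "0 \<le> q" "q + L \<le> L * int m"
        using bound[of a] bound[of b] by blast
      moreover have "0 \<le> L" using assms by simp
      ultimately show ?thesis using \<open>0 \<le> r\<close> unfolding Win_def N_def by auto
    qed
    then show "(\<Union>z\<in>J. Q z) \<subseteq> {v \<in> Win. 3 \<le> card (sides v \<inter> interface lab)}"
      unfolding Q_def by blast
  qed (simp add: Win_def)
  also have "\<dots> \<le> 2 * card J + 8 * N + 8"
    by (rule card_branching_le[OF finJ reg Win_def])
  finally show ?thesis by (simp add: N_def)
qed simp

end

section \<open>Distinct weights\<close>

lemma edge_mem_E2: "{x, y} \<in> E2 \<longleftrightarrow> lattice_adj x y"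
proof
  assume "{x, y} \<in> E2"
  then obtain a b where "{x, y} = {a, b}" "lattice_adj a b" by (auto simp: E2_def lattice_adj_def)
  then show "lattice_adj x y" by (auto simp: doubleton_eq_iff lattice_adj_sym)
next
  assume "lattice_adj x y"
  then show "{x, y} \<in> E2" unfolding E2_def lattice_adj_def by blast
qed

lemma finite_neighbours: "finite {z. lattice_adj x z}"
proof (rule finite_subset)
  show "{z. lattice_adj x z} \<subseteq> block 1 x" by (auto simp: lattice_adj_def mem_block)
qed simp

text \<open>Some minimizer always exists (\<open>nn_dir_nxt\<close>), and for distinct weights it is
  the only one (\<open>nn_dir_iff\<close>).\<close>

definition nxt :: "(vtx set \<Rightarrow> real) \<Rightarrow> vtx \<Rightarrow> vtx" where
  "nxt \<omega> x = (SOME y. nn_dir \<omega> x y)"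

definition backward :: "(vtx set \<Rightarrow> real) \<Rightarrow> vtx \<Rightarrow> vtx set" where
  "backward \<omega> y = {x. (nn_dir \<omega>)\<^sup>*\<^sup>* x y}"

lemma nn_dir_nxt: "nn_dir \<omega> x (nxt \<omega> x)"
proof -
  let ?N = "{z. lattice_adj x z}"
  have "(fst x + 1, snd x) \<in> ?N" by (simp add: lattice_adj_def)
  then obtain y where "is_arg_min (\<lambda>z. \<omega> {x, z}) (\<lambda>z. z \<in> ?N) y"
    using ex_is_arg_min_if_finite[OF finite_neighbours, of x "\<lambda>z. \<omega> {x, z}"] by blast
  then have "nn_dir \<omega> x y"
    unfolding is_arg_min_linorder nn_dir_def edge_mem_E2 by auto
  then show ?thesis unfolding nxt_def by (rule someI)
qed

locale distinct_weights =
  fixes \<omega> :: "vtx set \<Rightarrow> real"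
  assumes inj: "inj_on \<omega> E2"
begin

abbreviation F :: "vtx \<Rightarrow> vtx" where "F \<equiv> nxt \<omega>"

definition w :: "vtx \<Rightarrow> real" where "w x = \<omega> {x, F x}"

lemma F_adj: "lattice_adj x (F x)"
  using nn_dir_nxt[of \<omega> x] by (simp add: nn_dir_def edge_mem_E2)

lemma w_le: "lattice_adj x z \<Longrightarrow> w x \<le> \<omega> {x, z}"
  using nn_dir_nxt[of \<omega> x] unfolding w_def nn_dir_def edge_mem_E2 by blast

lemma same_weight_edge:
  "\<lbrakk>lattice_adj x y; lattice_adj x' y'; \<omega> {x, y} = \<omega> {x', y'}\<rbrakk> \<Longrightarrow> {x, y} = {x', y'}"
  using inj unfolding inj_on_def by (meson edge_mem_E2)

lemma nn_dir_iff: "nn_dir \<omega> x y \<longleftrightarrow> y = F x"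
proof
  assume "nn_dir \<omega> x y"
  then have "lattice_adj x y" "\<omega> {x, y} \<le> w x"
    using F_adj[of x] unfolding nn_dir_def w_def edge_mem_E2 by blast+
  then have "{x, y} = {x, F x}"
    using w_le[of x y] F_adj[of x] by (intro same_weight_edge) (auto simp: w_def)
  then show "y = F x" by (auto simp: doubleton_eq_iff)
qed (simp add: nn_dir_nxt)

lemma nn_dir_rtranclp_iff: "(nn_dir \<omega>)\<^sup>*\<^sup>* x y \<longleftrightarrow> (\<exists>n. y = (F ^^ n) x)"
proof -
  have "(nn_dir \<omega> ^^ n) x y \<longleftrightarrow> y = (F ^^ n) x" for n y
    by (induction n arbitrary: y) (auto simp: nn_dir_iff relcompp_apply)
  then show ?thesis by (simp add: rtranclp_power)
qed

text \<open>The edge from \<open>x\<close> to \<open>F x\<close> is also available at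
  \<open>F x\<close>.\<close>

lemma w_F_le: "w (F x) \<le> w x"
  using w_le[of "F x" x] F_adj[of x] by (simp add: w_def insert_commute lattice_adj_sym)

lemma w_funpow_antimono: "m \<le> n \<Longrightarrow> w ((F ^^ n) x) \<le> w ((F ^^ m) x)"
proof (induction n rule: dec_induct)
  case (step n)
  then show ?case using w_F_le[of "(F ^^ n) x"] by simp
qed simp

lemma w_eq: "w x = w y \<Longrightarrow> {x, F x} = {y, F y}"
  using same_weight_edge[OF F_adj F_adj] by (simp add: w_def)

lemma component_F: "nn_component \<omega> (F x) = nn_component \<omega> x"
proof -
  have "nn_adj \<omega> x (F x)" "nn_adj \<omega> (F x) x" by (auto simp: nn_adj_def nn_dir_iff)
  then show ?thesis unfolding nn_component_def by (auto intro: converse_rtranclp_into_rtranclp)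
qed

lemma component_funpow: "nn_component \<omega> ((F ^^ n) x) = nn_component \<omega> x"
  by (induction n) (auto simp: component_F)

text \<open>The vertices whose orbit hits \<open>y\<close> are closed under passing to a neighbour:
  a predecessor takes one step more, a successor one step less, and from \<open>y\<close> itself the
  successor \<open>F y\<close> returns to \<open>y\<close>.\<close>

lemma two_cycle_component:
  assumes "F (F y) = y"
  shows "nn_component \<omega> y \<subseteq> backward \<omega> y"
proof
  fix x assume "x \<in> nn_component \<omega> y"
  then have "(nn_adj \<omega>)\<^sup>*\<^sup>* y x" by (simp add: nn_component_def)
  then show "x \<in> backward \<omega> y"
  proof induction
    case base
    then show ?case by (simp add: backward_def)
  next
    case (step u v)
    then obtain n where n: "y = (F ^^ n) u" by (auto simp: backward_def nn_dir_rtranclp_iff)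
    from step.hyps(2) consider "v = F u" | "u = F v" by (auto simp: nn_adj_def nn_dir_iff)
    then have "\<exists>n. y = (F ^^ n) v"
    proof cases
      case 1
      show ?thesis
      proof (cases n)
        case 0
        then show ?thesis using n 1 assms by (intro exI[of _ 1]) simp
      next
        case (Suc k)
        then show ?thesis using n 1 by (intro exI[of _ k]) (simp add: funpow_swap1)
      qed
    next
      case 2
      then show ?thesis using n by (intro exI[of _ "Suc n"]) (simp add: funpow_swap1)
    qed
    then show ?case by (simp add: backward_def nn_dir_rtranclp_iff)
  qed
qed

text \<open>Weights do not increase along the orbit, so a repetition makes them constant in between;
  equal weights mean equal edges, which leaves only a two-cycle. Then the component lies in a finite
  backward cluster.\<close>

lemma inj_orbit:
  assumes fin: "\<And>y. finite (backward \<omega> y)" and inf: "infinite (nn_component \<omega> x)"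
  shows "inj (\<lambda>n. (F ^^ n) x)"
proof (rule ccontr)
  assume "\<not> inj (\<lambda>n. (F ^^ n) x)"
  then obtain m n where "m < n" and eq: "(F ^^ m) x = (F ^^ n) x"
    unfolding inj_def by (metis linorder_neq_iff)
  let ?y = "(F ^^ m) x"
  have "w ?y \<le> w (F ?y)"
    using w_funpow_antimono[of "Suc m" n x] \<open>m < n\<close> eq by simp
  then have "{?y, F ?y} = {F ?y, F (F ?y)}" using w_F_le[of ?y] by (intro w_eq) simp
  then have "F (F ?y) = ?y" by (auto simp: doubleton_eq_iff)
  then show False
    using finite_subset[OF two_cycle_component[of ?y] fin[of ?y]] inf by (simp add: component_funpow)
qed

end

text \<open>For distinct weights and fixed \<open>b\<close>, every vertex sends to at most one vertex, which is what
  mass transport needs.\<close>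

definition low :: "(vtx set \<Rightarrow> real) \<Rightarrow> real \<Rightarrow> vtx \<Rightarrow> bool" where
  "low \<omega> b x \<longleftrightarrow> (\<exists>z. {x, z} \<in> E2 \<and> \<omega> {x, z} < b)"

primrec first_below :: "(vtx set \<Rightarrow> real) \<Rightarrow> real \<Rightarrow> nat \<Rightarrow> vtx \<Rightarrow> vtx \<Rightarrow> bool" where
  "first_below \<omega> b 0 x y \<longleftrightarrow> x = y \<and> low \<omega> b x"
| "first_below \<omega> b (Suc n) x y \<longleftrightarrow> \<not> low \<omega> b x \<and> (\<exists>z. nn_dir \<omega> x z \<and> first_below \<omega> b n z y)"

definition sends :: "(vtx set \<Rightarrow> real) \<Rightarrow> real \<Rightarrow> vtx \<Rightarrow> vtx \<Rightarrow> bool" where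
  "sends \<omega> b x y \<longleftrightarrow> (\<exists>n. first_below \<omega> b n x y)"

section \<open>Backward clusters covered by received mass\<close>

context distinct_weights begin

lemma low_iff: "low \<omega> b x \<longleftrightarrow> w x < b"
  using order_le_less_trans[OF w_le[of x]] F_adj[of x] unfolding low_def edge_mem_E2 w_def by blast

lemma first_below_iff:
  "first_below \<omega> b n x y \<longleftrightarrow> y = (F ^^ n) x \<and> w y < b \<and> (\<forall>k<n. b \<le> w ((F ^^ k) x))"
proof (induction n arbitrary: x)
  case (Suc n)
  have "first_below \<omega> b (Suc n) x y \<longleftrightarrow> b \<le> w x \<and> first_below \<omega> b n (F x) y"
    by (simp add: low_iff nn_dir_iff not_less)
  then show ?case
    by (auto simp: Suc.IH All_less_Suc2 funpow_Suc_right simp del: funpow.simps(2) first_below.simps)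
qed (auto simp: low_iff)

lemma sends_unique:
  assumes "sends \<omega> b x y" "sends \<omega> b x y'"
  shows "y = y'"
proof -
  obtain m n where m: "y = (F ^^ m) x" "w y < b" "\<forall>k<m. b \<le> w ((F ^^ k) x)"
    and n: "y' = (F ^^ n) x" "w y' < b" "\<forall>k<n. b \<le> w ((F ^^ k) x)"
    using assms unfolding sends_def first_below_iff by blast
  have "\<not> m < n" "\<not> n < m" using m n by (auto simp flip: not_less)
  then have "m = n" by simp
  then show ?thesis using m n by simp
qed

text \<open>On an orbit leading to \<open>y\<close>, a step into \<open>y\<close> or
  \<open>F y\<close> before \<open>y\<close> is reached uses an edge of weight at least
  \<open>w y\<close>, so by \<open>gap\<close> of weight \<open>w y\<close> or at least
  \<open>b\<close>; weight \<open>w y\<close> means the edge between \<open>y\<close> and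
  \<open>F y\<close>. Hence the first vertex below \<open>b\<close> is \<open>y\<close> or, in a
  two-cycle, possibly \<open>F y\<close>.\<close>

lemma backward_subset:
  assumes b: "w y < b" and gap: "\<And>u z. u \<in> {y, F y} \<Longrightarrow> lattice_adj u z \<Longrightarrow> \<omega> {u, z} < b \<Longrightarrow> \<omega> {u, z} \<le> w y"
  shows "backward \<omega> y \<subseteq> {x. sends \<omega> b x y} \<union> {x. sends \<omega> b x (F y)}"
proof
  fix x assume "x \<in> backward \<omega> y"
  then obtain n where n: "y = (F ^^ n) x" by (auto simp: backward_def nn_dir_rtranclp_iff)
  define k where "k = (LEAST k. w ((F ^^ k) x) < b)"
  have "w ((F ^^ n) x) < b" using b n by simp
  then have k: "w ((F ^^ k) x) < b" and "k \<le> n" unfolding k_def by (rule LeastI, rule Least_le)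
  have before: "b \<le> w ((F ^^ i) x)" if "i < k" for i
    using not_less_Least[of i "\<lambda>k. w ((F ^^ k) x) < b"] that unfolding k_def by simp
  \<comment> \<open>Going back from time \<open>n\<close> to time \<open>k\<close>, every vertex
    passed has weight below \<open>b\<close>.\<close>
  have "(F ^^ k) x \<in> {y, F y}"
    using \<open>k \<le> n\<close>
  proof (induction k rule: inc_induct)
    case base
    then show ?case using n by simp
  next
    case (step i)
    let ?u = "(F ^^ i) x"
    have "lattice_adj (F ?u) ?u" using F_adj lattice_adj_sym by blast
    have "w ?u < b" using w_funpow_antimono[of k i x] step.hyps k by simp
    then have "w ?u \<le> w y"
      using gap[of "F ?u" ?u] step.IH \<open>lattice_adj (F ?u) ?u\<close> by (simp add: w_def insert_commute)
    moreover have "w y \<le> w ?u" using w_funpow_antimono[of i n x] n step.hyps by simp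
    ultimately have "{?u, F ?u} = {y, F y}" by (intro w_eq) simp
    then show ?case by (auto simp: doubleton_eq_iff)
  qed
  moreover have "sends \<omega> b x ((F ^^ k) x)"
    unfolding sends_def first_below_iff using k before by blast
  ultimately show "x \<in> {x. sends \<omega> b x y} \<union> {x. sends \<omega> b x (F y)}" by auto
qed

lemma finite_backward:
  assumes "\<And>(q :: rat) y. finite {x. sends \<omega> (of_rat q) x y}"
  shows "finite (backward \<omega> y)"
proof -
  \<comment> \<open>\<open>A\<close> contains all weights above \<open>w y\<close> of edges at
    \<open>y\<close> or \<open>F y\<close>, as the ends of these edges lie in
    \<open>block 2 y\<close>. The rational \<open>q\<close> is put between \<open>w y\<close> and
    these weights; \<open>w y + 1\<close> ensures that the minimum exists.\<close>
  define A where "A = {t \<in> (\<lambda>(u, z). \<omega> {u, z}) ` (block 2 y \<times> block 2 y). w y < t}"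
  have "finite A" by (simp add: A_def)
  define c where "c = Min (insert (w y + 1) A)"
  have "w y < c" unfolding c_def using \<open>finite A\<close> by (auto simp: A_def)
  then obtain q :: rat where q: "w y < of_rat q" "of_rat q < c" using of_rat_dense by blast
  have "backward \<omega> y \<subseteq> {x. sends \<omega> (of_rat q) x y} \<union> {x. sends \<omega> (of_rat q) x (F y)}"
  proof (rule backward_subset[OF q(1)])
    fix u z assume u: "u \<in> {y, F y}" "lattice_adj u z" "\<omega> {u, z} < of_rat q"
    show "\<omega> {u, z} \<le> w y"
    proof (rule ccontr)
      assume "\<not> \<omega> {u, z} \<le> w y"
      moreover have "u \<in> block 2 y" "z \<in> block 2 y"
        using u F_adj[of y] by (auto simp: mem_block lattice_adj_def)
      ultimately have "\<omega> {u, z} \<in> A" unfolding A_def by force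
      then have "c \<le> \<omega> {u, z}" unfolding c_def using \<open>finite A\<close> by (intro Min_le) auto
      then show False using u q by simp
    qed
  qed
  then show ?thesis using assms finite_subset by blast
qed

end

section \<open>Translations\<close>

lemma shift_vtx_inverse [simp]:
  "shift_vtx z (shift_vtx (- fst z, - snd z) x) = x"
  "shift_vtx (- fst z, - snd z) (shift_vtx z x) = x"
  by (simp_all add: shift_vtx_def)

lemma bij_shift_vtx: "bij (shift_vtx z)"
  by (rule bij_betw_byWitness[where f' = "shift_vtx (- fst z, - snd z)"]) auto

lemma all_shift_vtx: "(\<forall>x. Q (shift_vtx z x)) \<longleftrightarrow> (\<forall>x. Q x)"
  by (metis shift_vtx_inverse(1))

lemma ex_shift_vtx: "(\<exists>x. Q (shift_vtx z x)) \<longleftrightarrow> (\<exists>x. Q x)"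
  by (metis shift_vtx_inverse(1))

lemma lattice_adj_shift: "lattice_adj (shift_vtx z x) (shift_vtx z y) \<longleftrightarrow> lattice_adj x y"
  by (simp add: lattice_adj_def shift_vtx_def)

lemma T_edge: "lattice_adj x y \<Longrightarrow> T z \<omega> {x, y} = \<omega> {shift_vtx z x, shift_vtx z y}"
  by (simp add: T_def edge_mem_E2 shift_edge_def)

lemma nn_dir_T: "nn_dir (T z \<omega>) x y \<longleftrightarrow> nn_dir \<omega> (shift_vtx z x) (shift_vtx z y)"
proof -
  let ?s = "shift_vtx z"
  have "nn_dir \<omega> (?s x) (?s y) \<longleftrightarrow> lattice_adj (?s x) (?s y) \<and>
      (\<forall>v. lattice_adj (?s x) (?s v) \<longrightarrow> \<omega> {?s x, ?s y} \<le> \<omega> {?s x, ?s v})"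
    unfolding nn_dir_def edge_mem_E2
    by (subst all_shift_vtx[of "\<lambda>v. lattice_adj (?s x) v \<longrightarrow> \<omega> {?s x, ?s y} \<le> \<omega> {?s x, v}" z]) (rule refl)
  also have "\<dots> \<longleftrightarrow> nn_dir (T z \<omega>) x y"
    unfolding nn_dir_def edge_mem_E2 lattice_adj_shift using T_edge by metis
  finally show ?thesis by simp
qed

lemma nn_adj_T: "nn_adj (T z \<omega>) x y \<longleftrightarrow> nn_adj \<omega> (shift_vtx z x) (shift_vtx z y)"
  by (simp add: nn_adj_def nn_dir_T)

lemma low_T: "low (T z \<omega>) b x \<longleftrightarrow> low \<omega> b (shift_vtx z x)"
proof -
  let ?s = "shift_vtx z"
  have "low \<omega> b (?s x) \<longleftrightarrow> (\<exists>v. lattice_adj (?s x) (?s v) \<and> \<omega> {?s x, ?s v} < b)"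
    unfolding low_def edge_mem_E2
    by (subst ex_shift_vtx[of "\<lambda>v. lattice_adj (?s x) v \<and> \<omega> {?s x, v} < b" z]) (rule refl)
  also have "\<dots> \<longleftrightarrow> low (T z \<omega>) b x"
    unfolding low_def edge_mem_E2 lattice_adj_shift using T_edge by metis
  finally show ?thesis by simp
qed

lemma first_below_T:
  "first_below (T z \<omega>) b n x y \<longleftrightarrow> first_below \<omega> b n (shift_vtx z x) (shift_vtx z y)"
proof (induction n arbitrary: x)
  case 0
  show ?case using bij_is_inj[OF bij_shift_vtx[of z]] by (auto simp: low_T inj_eq)
next
  case (Suc n)
  show ?case
    unfolding first_below.simps low_T nn_dir_T Suc
    by (subst ex_shift_vtx[of "\<lambda>v. nn_dir \<omega> (shift_vtx z x) v \<and> first_below \<omega> b n v (shift_vtx z y)" z]) (rule refl)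
qed

lemma sends_T: "sends (T z \<omega>) b x y \<longleftrightarrow> sends \<omega> b (shift_vtx z x) (shift_vtx z y)"
  by (simp add: sends_def first_below_T)

lemma rtranclp_shift_vtx:
  "(\<lambda>x y. R (shift_vtx z x) (shift_vtx z y))\<^sup>*\<^sup>* x y \<longleftrightarrow> R\<^sup>*\<^sup>* (shift_vtx z x) (shift_vtx z y)"
  (is "?S\<^sup>*\<^sup>* x y \<longleftrightarrow> _")
proof
  assume "?S\<^sup>*\<^sup>* x y"
  then show "R\<^sup>*\<^sup>* (shift_vtx z x) (shift_vtx z y)"
    by induction (auto intro: rtranclp.rtrancl_into_rtrancl)
next
  have "R\<^sup>*\<^sup>* (shift_vtx z x) v \<Longrightarrow> ?S\<^sup>*\<^sup>* x (shift_vtx (- fst z, - snd z) v)" for v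
  proof (induction rule: rtranclp_induct)
    case (step u v)
    have "?S (shift_vtx (- fst z, - snd z) u) (shift_vtx (- fst z, - snd z) v)"
      using step.hyps(2) by simp
    then show ?case by (rule rtranclp.rtrancl_into_rtrancl[OF step.IH])
  qed simp
  then show "R\<^sup>*\<^sup>* (shift_vtx z x) (shift_vtx z y) \<Longrightarrow> ?S\<^sup>*\<^sup>* x y"
    using shift_vtx_inverse(2) by metis
qed

lemma nn_dir_rtranclp_T:
  "(nn_dir (T z \<omega>))\<^sup>*\<^sup>* x y \<longleftrightarrow> (nn_dir \<omega>)\<^sup>*\<^sup>* (shift_vtx z x) (shift_vtx z y)"
  by (subst rtranclp_shift_vtx[symmetric]) (simp add: nn_dir_T[abs_def])

lemma nn_adj_rtranclp_T:
  "(nn_adj (T z \<omega>))\<^sup>*\<^sup>* x y \<longleftrightarrow> (nn_adj \<omega>)\<^sup>*\<^sup>* (shift_vtx z x) (shift_vtx z y)"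
  by (subst rtranclp_shift_vtx[symmetric]) (simp add: nn_adj_T[abs_def])

text \<open>Infinitude is rewritten with countable quantifiers, which keeps it measurable.\<close>

lemma infinite_iff_leaves_blocks: "infinite S \<longleftrightarrow> (\<forall>n::nat. \<exists>y. y \<notin> block (int n) (0, 0) \<and> y \<in> S)"
proof
  show "\<forall>n::nat. \<exists>y. y \<notin> block (int n) (0, 0) \<and> y \<in> S" if "infinite S"
    using that by (meson finite_block finite_subset subsetI)
next
  assume leaves: "\<forall>n::nat. \<exists>y. y \<notin> block (int n) (0, 0) \<and> y \<in> S"
  show "infinite S"
  proof
    assume "finite S"
    define M where "M = Max (insert 0 ((\<lambda>y. \<bar>fst y\<bar> + \<bar>snd y\<bar>) ` S))"
    have "\<bar>fst y\<bar> + \<bar>snd y\<bar> \<le> M" if "y \<in> S" for y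
      unfolding M_def using \<open>finite S\<close> that by (intro Max_ge) auto
    then have "y \<in> block (int (nat M)) (0, 0)" if "y \<in> S" for y
      using that by (fastforce simp: mem_block)
    then show False using leaves by blast
  qed
qed

text \<open>A version of \<^const>\<open>encounter\<close> for the nearest neighbour graph that is visibly measurable.\<close>

definition nn_encounter :: "int \<Rightarrow> int \<Rightarrow> (vtx set \<Rightarrow> real) \<Rightarrow> bool" where
  "nn_encounter r K \<omega> \<longleftrightarrow>
     (\<exists>x1 x2 x3. x1 \<in> block r (0, 0) \<and> x2 \<in> block r (0, 0) \<and> x3 \<in> block r (0, 0) \<and>
       \<not> (nn_adj \<omega>)\<^sup>*\<^sup>* x1 x2 \<and> \<not> (nn_adj \<omega>)\<^sup>*\<^sup>* x1 x3 \<and> \<not> (nn_adj \<omega>)\<^sup>*\<^sup>* x2 x3 \<and>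
       (\<forall>n::nat. \<exists>y. y \<notin> block (int n) (0, 0) \<and> (nn_adj \<omega>)\<^sup>*\<^sup>* x1 y) \<and>
       (\<forall>n::nat. \<exists>y. y \<notin> block (int n) (0, 0) \<and> (nn_adj \<omega>)\<^sup>*\<^sup>* x2 y) \<and>
       (\<forall>n::nat. \<exists>y. y \<notin> block (int n) (0, 0) \<and> (nn_adj \<omega>)\<^sup>*\<^sup>* x3 y)) \<and>
     (\<forall>y x. y \<in> block r (0, 0) \<longrightarrow> (nn_dir \<omega>)\<^sup>*\<^sup>* x y \<longrightarrow> x \<in> block K y)"

lemma nn_encounter_iff:
  "nn_encounter r K \<omega> \<longleftrightarrow>
     (\<exists>x1 x2 x3. {x1, x2, x3} \<subseteq> block r (0, 0) \<and>
       \<not> (nn_adj \<omega>)\<^sup>*\<^sup>* x1 x2 \<and> \<not> (nn_adj \<omega>)\<^sup>*\<^sup>* x1 x3 \<and> \<not> (nn_adj \<omega>)\<^sup>*\<^sup>* x2 x3 \<and>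
       (\<forall>x\<in>{x1, x2, x3}. infinite (nn_component \<omega> x))) \<and>
     (\<forall>y\<in>block r (0, 0). \<forall>x. (nn_dir \<omega>)\<^sup>*\<^sup>* x y \<longrightarrow> x \<in> block K y)"
  unfolding nn_encounter_def infinite_iff_leaves_blocks nn_component_def
  by (simp add: Ball_def[of "block r (0, 0)"] del: split_paired_All split_paired_Ex)

lemma nn_component_T: "nn_component \<omega> (shift_vtx z x) = shift_vtx z ` nn_component (T z \<omega>) x"
proof
  show "nn_component \<omega> (shift_vtx z x) \<subseteq> shift_vtx z ` nn_component (T z \<omega>) x"
  proof
    fix y assume "y \<in> nn_component \<omega> (shift_vtx z x)"
    then have "shift_vtx (- fst z, - snd z) y \<in> nn_component (T z \<omega>) x"
      by (simp add: nn_component_def nn_adj_rtranclp_T)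
    then show "y \<in> shift_vtx z ` nn_component (T z \<omega>) x" by force
  qed
qed (auto simp: nn_component_def nn_adj_rtranclp_T)

lemma mem_block_shift: "shift_vtx z x \<in> block r (shift_vtx z y) \<longleftrightarrow> x \<in> block r y"
  by (simp add: mem_block shift_vtx_def)

context distinct_weights begin

lemma component_eq_iff: "nn_component \<omega> x = nn_component \<omega> y \<longleftrightarrow> (nn_adj \<omega>)\<^sup>*\<^sup>* x y"
proof -
  have "symp (nn_adj \<omega>)" by (auto simp: symp_def nn_adj_def)
  then have sym: "(nn_adj \<omega>)\<^sup>*\<^sup>* u v \<Longrightarrow> (nn_adj \<omega>)\<^sup>*\<^sup>* v u" for u v
    using symp_rtranclp sympD by metis
  show ?thesis
  proof
    assume "nn_component \<omega> x = nn_component \<omega> y"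
    moreover have "y \<in> nn_component \<omega> y" by (simp add: nn_component_def)
    ultimately have "y \<in> nn_component \<omega> x" by simp
    then show "(nn_adj \<omega>)\<^sup>*\<^sup>* x y" by (simp add: nn_component_def)
  next
    assume xy: "(nn_adj \<omega>)\<^sup>*\<^sup>* x y"
    have "(nn_adj \<omega>)\<^sup>*\<^sup>* x v \<longleftrightarrow> (nn_adj \<omega>)\<^sup>*\<^sup>* y v" for v
      using rtranclp_trans[OF xy] rtranclp_trans[OF sym[OF xy]] by blast
    then show "nn_component \<omega> x = nn_component \<omega> y" by (simp add: nn_component_def)
  qed
qed

text \<open>The origin in \<open>T z \<omega>\<close> corresponds to \<open>z\<close> in
  \<open>\<omega>\<close>, and sites of infinite components have injective orbits by
  \<open>inj_orbit\<close>.\<close>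

lemma encounter_of_nn_encounter:
  assumes fin: "\<And>y. finite (backward \<omega> y)" and enc: "nn_encounter r K (T z \<omega>)"
  shows "encounter F (nn_component \<omega>) r K z"
proof -
  let ?s = "shift_vtx z"
  have s0: "?s (0, 0) = z" by (simp add: shift_vtx_def)
  obtain x1 x2 x3 where x: "{x1, x2, x3} \<subseteq> block r (0, 0)"
      "\<not> (nn_adj \<omega>)\<^sup>*\<^sup>* (?s x1) (?s x2)" "\<not> (nn_adj \<omega>)\<^sup>*\<^sup>* (?s x1) (?s x3)"
      "\<not> (nn_adj \<omega>)\<^sup>*\<^sup>* (?s x2) (?s x3)"
      "\<forall>x\<in>{x1, x2, x3}. infinite (nn_component (T z \<omega>) x)"
    and bwd: "\<forall>y\<in>block r (0, 0). \<forall>x. (nn_dir \<omega>)\<^sup>*\<^sup>* (?s x) (?s y) \<longrightarrow> x \<in> block K y"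
    using enc unfolding nn_encounter_iff nn_dir_rtranclp_T nn_adj_rtranclp_T by blast
  have block: "?s v \<in> block r z \<longleftrightarrow> v \<in> block r (0, 0)" for v
    using mem_block_shift[of z v r "(0, 0)"] s0 by simp
  show ?thesis
    unfolding encounter_def
  proof (intro conjI exI[of _ "{?s x1, ?s x2, ?s x3}"] allI impI)
    show "{?s x1, ?s x2, ?s x3} \<subseteq> block r z" using x(1) block by auto
    show "3 \<le> card (nn_component \<omega> ` {?s x1, ?s x2, ?s x3})"
      using x(2-4) by (simp add: component_eq_iff)
    show "\<forall>x\<in>{?s x1, ?s x2, ?s x3}. inj (\<lambda>n. (F ^^ n) x)"
    proof
      fix v assume "v \<in> {?s x1, ?s x2, ?s x3}"
      then obtain u where u: "v = ?s u" "infinite (nn_component (T z \<omega>) u)" using x(5) by blast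
      have "inj_on ?s A" for A using bij_is_inj[OF bij_shift_vtx] inj_on_subset by blast
      then have "infinite (nn_component \<omega> v)"
        using u by (simp add: nn_component_T finite_image_iff)
      then show "inj (\<lambda>n. (F ^^ n) v)" by (rule inj_orbit[OF fin])
    qed
  next
    fix x n assume "(F ^^ n) x \<in> block r z"
    define u where "u = shift_vtx (- fst z, - snd z) x"
    define v where "v = shift_vtx (- fst z, - snd z) ((F ^^ n) x)"
    have uv: "x = ?s u" "(F ^^ n) x = ?s v" by (simp_all add: u_def v_def)
    have "(nn_dir \<omega>)\<^sup>*\<^sup>* (?s u) (?s v)"
      unfolding uv[symmetric] nn_dir_rtranclp_iff by blast
    moreover have "v \<in> block r (0, 0)" using \<open>(F ^^ n) x \<in> block r z\<close> block uv(2) by simp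
    ultimately have "u \<in> block K v" using bwd by blast
    then show "x \<in> block K ((F ^^ n) x)" unfolding uv(2) by (simp add: uv(1) mem_block_shift)
  qed
qed

text \<open>Three infinite components would all meet some block around the origin, and the backward
  clusters of its finitely many sites are jointly bounded, which gives an encounter.\<close>

lemma card_infinite_components_le:
  assumes fin: "\<And>y. finite (backward \<omega> y)" and no: "\<And>r K :: nat. \<not> nn_encounter (int r) (int K) \<omega>"
  shows "finite (infinite_components \<omega>) \<and> card (infinite_components \<omega>) \<le> 2"
proof (rule ccontr)
  assume many: "\<not> ?thesis"
  have "\<exists>S \<subseteq> infinite_components \<omega>. card S = 3"
  proof (cases "finite (infinite_components \<omega>)")
    case True
    then show ?thesis using many obtain_subset_with_card_n[of 3 "infinite_components \<omega>"] by auto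
  next
    case False
    then show ?thesis using infinite_arbitrarily_large[of "infinite_components \<omega>" 3] by blast
  qed
  then obtain S where S: "S \<subseteq> infinite_components \<omega>" "card S = 3" by blast
  then obtain C1 C2 C3 where C: "S = {C1, C2, C3}" "C1 \<noteq> C2" "C1 \<noteq> C3" "C2 \<noteq> C3"
    unfolding card_3_iff by blast
  have rep: "\<exists>x. D = nn_component \<omega> x \<and> infinite D" if "D \<in> S" for D
    using that S(1) by (auto simp: infinite_components_def)
  obtain x1 where x1: "C1 = nn_component \<omega> x1" "infinite C1" using rep[of C1] C(1) by blast
  obtain x2 where x2: "C2 = nn_component \<omega> x2" "infinite C2" using rep[of C2] C(1) by blast
  obtain x3 where x3: "C3 = nn_component \<omega> x3" "infinite C3" using rep[of C3] C(1) by blast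
  have bound: "\<exists>n::nat. A \<subseteq> block (int n) (0, 0)" if "finite A" for A
    using that infinite_iff_leaves_blocks[of A] by blast
  obtain r where r: "{x1, x2, x3} \<subseteq> block (int r) (0, 0)" using bound[of "{x1, x2, x3}"] by auto
  have "finite (\<Union>y\<in>block (int r) (0, 0). backward \<omega> y)" using fin by auto
  then obtain k where k: "(\<Union>y\<in>block (int r) (0, 0). backward \<omega> y) \<subseteq> block (int k) (0, 0)"
    using bound by blast
  \<comment> \<open>The clusters are bounded by \<open>k\<close> around the origin; around a site of
    the block the radius grows by at most \<open>r\<close>.\<close>
  have "nn_encounter (int r) (int (r + k)) \<omega>"
    unfolding nn_encounter_iff
  proof (rule conjI)
    have "\<not> (nn_adj \<omega>)\<^sup>*\<^sup>* x1 x2" "\<not> (nn_adj \<omega>)\<^sup>*\<^sup>* x1 x3" "\<not> (nn_adj \<omega>)\<^sup>*\<^sup>* x2 x3"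
      using C x1 x2 x3 by (simp_all flip: component_eq_iff)
    moreover have "\<forall>v\<in>{x1, x2, x3}. infinite (nn_component \<omega> v)"
      using x1 x2 x3 by simp
    ultimately show "\<exists>x1 x2 x3. {x1, x2, x3} \<subseteq> block (int r) (0, 0) \<and>
       \<not> (nn_adj \<omega>)\<^sup>*\<^sup>* x1 x2 \<and> \<not> (nn_adj \<omega>)\<^sup>*\<^sup>* x1 x3 \<and> \<not> (nn_adj \<omega>)\<^sup>*\<^sup>* x2 x3 \<and>
       (\<forall>x\<in>{x1, x2, x3}. infinite (nn_component \<omega> x))"
      using r by blast
    show "\<forall>y\<in>block (int r) (0, 0). \<forall>x. (nn_dir \<omega>)\<^sup>*\<^sup>* x y \<longrightarrow> x \<in> block (int (r + k)) y"
    proof (intro ballI allI impI)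
      fix y u assume y: "y \<in> block (int r) (0, 0)" and "(nn_dir \<omega>)\<^sup>*\<^sup>* u y"
      then have "u \<in> block (int k) (0, 0)" using k unfolding backward_def by blast
      then show "u \<in> block (int (r + k)) y" using y unfolding mem_block by auto
    qed
  qed
  then show False using no by blast
qed

end

section \<open>Stationary weights\<close>

locale stationary_weights = prob_space P for P :: "(vtx set \<Rightarrow> real) measure" +
  assumes sets_P: "sets P = sets Omega"
    and stationary: "\<And>z. distr P P (T z) = P"
    and no_ties: "\<And>e f. e \<in> E2 \<Longrightarrow> f \<in> E2 \<Longrightarrow> e \<noteq> f \<Longrightarrow> prob {\<omega> \<in> space P. \<omega> e = \<omega> f} = 0"
begin

section \<open>Measurability and translation invariance of events\<close>

lemma weight_measurable: "e \<in> E2 \<Longrightarrow> (\<lambda>\<omega>. \<omega> e) \<in> borel_measurable P"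
  unfolding measurable_cong_sets[OF sets_P refl] Omega_def by (rule measurable_component_singleton)

lemma T_measurable: "T z \<in> P \<rightarrow>\<^sub>M P"
proof -
  have "T z \<in> P \<rightarrow>\<^sub>M Omega"
    unfolding T_def[abs_def] Omega_def
  proof (rule measurable_restrict)
    fix e assume "e \<in> E2"
    then obtain x y where "e = {x, y}" "lattice_adj x y" by (auto simp: E2_def lattice_adj_def)
    then have "shift_edge z e \<in> E2"
      by (simp add: shift_edge_def edge_mem_E2 lattice_adj_shift)
    then show "(\<lambda>\<omega>. \<omega> (shift_edge z e)) \<in> borel_measurable P" by (rule weight_measurable)
  qed
  then show ?thesis using measurable_cong_sets[OF refl sets_P] by blast
qed

lemma prob_T:
  assumes "Measurable.pred P Q"
  shows "prob {\<omega> \<in> space P. Q (T z \<omega>)} = prob {\<omega> \<in> space P. Q \<omega>}"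
proof -
  have "{\<omega> \<in> space P. Q \<omega>} \<in> events" using assms by measurable
  then have "measure (distr P P (T z)) {\<omega> \<in> space P. Q \<omega>} =
      prob (T z -` {\<omega> \<in> space P. Q \<omega>} \<inter> space P)"
    by (rule measure_distr[OF T_measurable])
  also have "T z -` {\<omega> \<in> space P. Q \<omega>} \<inter> space P = {\<omega> \<in> space P. Q (T z \<omega>)}"
    using measurable_space[OF T_measurable[of z]] by auto
  finally show ?thesis by (simp add: stationary)
qed

lemma nn_dir_measurable [measurable]: "Measurable.pred P (\<lambda>\<omega>. nn_dir \<omega> x y)"
proof (cases "{x, y} \<in> E2")
  case True
  have "Measurable.pred P (\<lambda>\<omega>. {x, z} \<in> E2 \<longrightarrow> \<omega> {x, y} \<le> \<omega> {x, z})" for z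
  proof (cases "{x, z} \<in> E2")
    case z: True
    show ?thesis
      using borel_measurable_le[OF weight_measurable[OF True] weight_measurable[OF z]] z
      by (simp add: pred_def)
  qed simp
  then have "Measurable.pred P (\<lambda>\<omega>. \<forall>z. {x, z} \<in> E2 \<longrightarrow> \<omega> {x, y} \<le> \<omega> {x, z})"
    by measurable
  then show ?thesis using True by (simp add: nn_dir_def)
qed (simp add: nn_dir_def)

lemma nn_adj_measurable [measurable]: "Measurable.pred P (\<lambda>\<omega>. nn_adj \<omega> x y)"
  unfolding nn_adj_def by measurable

text \<open>The closure is a countable union over path lengths, and each further step a countable
  union over the intermediate vertex.\<close>

lemma rtranclp_measurable:
  assumes [measurable]: "\<And>x y :: vtx. Measurable.pred P (\<lambda>\<omega>. R \<omega> x y)"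
  shows "Measurable.pred P (\<lambda>\<omega>. (R \<omega>)\<^sup>*\<^sup>* x y)"
proof -
  have [measurable]: "Measurable.pred P (\<lambda>\<omega>. (R \<omega> ^^ n) x y)" for n y
    by (induction n arbitrary: y) (simp_all add: relcompp_apply)
  show ?thesis unfolding rtranclp_power by measurable
qed

lemmas [measurable] = rtranclp_measurable[OF nn_dir_measurable] rtranclp_measurable[OF nn_adj_measurable]

lemma low_measurable [measurable]: "Measurable.pred P (\<lambda>\<omega>. low \<omega> b x)"
proof -
  have "Measurable.pred P (\<lambda>\<omega>. {x, z} \<in> E2 \<and> \<omega> {x, z} < b)" for z
  proof (cases "{x, z} \<in> E2")
    case True
    show ?thesis
      using borel_measurable_less[OF weight_measurable[OF True] borel_measurable_const[of b]] True
      by (simp add: pred_def)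
  qed simp
  then show ?thesis unfolding low_def by measurable
qed

lemma sends_measurable [measurable]: "Measurable.pred P (\<lambda>\<omega>. sends \<omega> b x y)"
proof -
  have [measurable]: "Measurable.pred P (\<lambda>\<omega>. first_below \<omega> b n x y)" for n
    by (induction n arbitrary: x) simp_all
  show ?thesis unfolding sends_def by measurable
qed

lemma nn_encounter_measurable [measurable]: "Measurable.pred P (nn_encounter r K)"
  unfolding nn_encounter_def[abs_def] by measurable

section \<open>Almost sure properties\<close>

lemma AE_distinct_weights: "AE \<omega> in P. distinct_weights \<omega>"
proof -
  \<comment> \<open>Edges are given by their end points because the quantifiers must range over
    countable types: \<open>vtx\<close> is countable, \<open>vtx set\<close> is not.\<close>
  have "AE \<omega> in P. \<omega> {x, y} = \<omega> {x', y'} \<longrightarrow> {x, y} \<in> E2 \<longrightarrow> {x', y'} \<in> E2 \<longrightarrow> {x, y} = {x', y'}"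
    for x y x' y'
  proof (cases "{x, y} \<in> E2 \<and> {x', y'} \<in> E2 \<and> {x, y} \<noteq> {x', y'}")
    case True
    then have "{\<omega> \<in> space P. \<omega> {x, y} = \<omega> {x', y'}} \<in> events"
      by (intro borel_measurable_eq weight_measurable) auto
    then have "AE \<omega> in P. \<omega> {x, y} \<noteq> \<omega> {x', y'}"
      using no_ties[of "{x, y}" "{x', y'}"] True by (simp add: prob_Collect_eq_0)
    then show ?thesis by eventually_elim auto
  qed auto
  then have "AE \<omega> in P. \<forall>x y x' y'.
      \<omega> {x, y} = \<omega> {x', y'} \<longrightarrow> {x, y} \<in> E2 \<longrightarrow> {x', y'} \<in> E2 \<longrightarrow> {x, y} = {x', y'}"
    by (simp only: AE_all_countable simp_thms)
  then show ?thesis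
  proof eventually_elim
    case (elim \<omega>)
    have "\<exists>x y. e = {x, y}" if "e \<in> E2" for e using that by (auto simp: E2_def)
    then have "inj_on \<omega> E2" using elim unfolding inj_on_def by metis
    then show ?case by unfold_locales
  qed
qed

text \<open>Mass transport: by stationarity the expected mass received at \<open>y\<close> equals
  the expected mass sent from \<open>y\<close>, which is at most one by \<open>sends_unique\<close>.
  The first Borel-Cantelli lemma then makes the received mass finite.\<close>

lemma AE_finite_received: "AE \<omega> in P. finite {x. sends \<omega> b x y}"
proof -
  define e :: "nat \<Rightarrow> vtx" where "e = from_nat_into UNIV"
  have "infinite (UNIV :: vtx set)" by (simp add: finite_prod)
  then have e: "bij e" unfolding e_def by (intro bij_betw_from_nat_into) auto
  \<comment> \<open>The translation that takes \<open>e n\<close> to \<open>y\<close> takes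
    \<open>y\<close> to \<open>e' n\<close>, the reflection of \<open>e n\<close> in
    \<open>y\<close>.\<close>
  define e' where "e' n = (2 * fst y - fst (e n), 2 * snd y - snd (e n))" for n
  have "inj e'" using bij_is_inj[OF e] by (auto simp: e'_def inj_def prod_eq_iff)
  obtain N where N: "N \<in> null_sets P" "{\<omega> \<in> space P. \<not> distinct_weights \<omega>} \<subseteq> N"
    using AE_distinct_weights by (auto elim!: AE_E simp: null_sets_def)
  define A where "A n = {\<omega> \<in> space P. sends \<omega> b (e n) y}" for n
  \<comment> \<open>Off the null set \<open>N\<close> the vertex \<open>y\<close> sends to at most
    one vertex, so these events are disjoint.\<close>
  define B where "B n = {\<omega> \<in> space P. sends \<omega> b y (e' n)} - N" for n
  have A_events: "A n \<in> events" for n unfolding A_def by measurable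
  have B_events: "B n \<in> events" for n
  proof -
    have "{\<omega> \<in> space P. sends \<omega> b y (e' n)} \<in> events" by measurable
    then show ?thesis using null_setsD2[OF N(1)] unfolding B_def by (rule sets.Diff)
  qed
  have "prob (A n) = prob (B n)" for n
  proof -
    define z where "z = (fst y - fst (e n), snd y - snd (e n))"
    have "shift_vtx z (e n) = y" "shift_vtx z y = e' n"
      by (auto simp: shift_vtx_def z_def e'_def prod_eq_iff)
    then have "prob {\<omega> \<in> space P. sends \<omega> b y (e' n)} = prob {\<omega> \<in> space P. sends (T z \<omega>) b (e n) y}"
      by (simp add: sends_T)
    also have "\<dots> = prob (A n)" unfolding A_def by (rule prob_T) measurable
    moreover have "{\<omega> \<in> space P. sends \<omega> b y (e' n)} \<in> events" by measurable
    ultimately show ?thesis using N(1) unfolding B_def by (simp add: measure_Diff_null_set)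
  qed
  moreover have "disjoint_family B"
    unfolding disjoint_family_on_def
  proof (intro ballI impI equals0I)
    fix m n \<omega> assume "m \<noteq> n" and \<omega>: "\<omega> \<in> B m \<inter> B n"
    then interpret distinct_weights \<omega> using N(2) by (auto simp: B_def)
    have "e' m = e' n" using \<omega> by (intro sends_unique) (auto simp: B_def)
    then show False using \<open>m \<noteq> n\<close> \<open>inj e'\<close> by (simp add: inj_eq)
  qed
  ultimately have "summable (\<lambda>n. prob (A n))"
    using finite_measure_UNION[of B] B_events by (auto simp: sums_iff)
  then have "AE \<omega> in P. eventually (\<lambda>n. \<omega> \<in> space P - A n) sequentially"
    using A_events by (intro borel_cantelli_AE1) (auto simp: emeasure_eq_measure)
  then show ?thesis
  proof eventually_elim
    case (elim \<omega>)
    then obtain n0 where n0: "\<And>n. n \<ge> n0 \<Longrightarrow> \<omega> \<in> space P - A n"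
      by (auto simp: eventually_sequentially)
    have "{x. sends \<omega> b x y} \<subseteq> e ` {..<n0}"
    proof
      fix x assume x: "x \<in> {x. sends \<omega> b x y}"
      obtain n where "x = e n" using bij_is_surj[OF e] by (metis surjD)
      then have "\<not> n0 \<le> n" using n0[of n] x n0[of n0] by (auto simp: A_def)
      then show "x \<in> e ` {..<n0}" using \<open>x = e n\<close> by simp
    qed
    then show ?case by (rule finite_subset) simp
  qed
qed

lemma AE_finite_backward: "AE \<omega> in P. \<forall>y. finite (backward \<omega> y)"
proof -
  have "AE \<omega> in P. \<forall>(q :: rat) y. finite {x. sends \<omega> (of_rat q) x y}"
    by (simp only: AE_all_countable) (intro allI AE_finite_received)
  with AE_distinct_weights show ?thesis
    by eventually_elim (auto intro: distinct_weights.finite_backward)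
qed

text \<open>By stationarity the expected number of encounters among the grid points is
  \<open>m * m * p\<close>, but \<open>card_encounters_le\<close> bounds the number almost surely by
  a multiple of \<open>m\<close>; a large \<open>m\<close> excludes \<open>0 < p\<close>.\<close>

lemma prob_nn_encounter: "prob {\<omega> \<in> space P. nn_encounter (int r) (int K) \<omega>} = 0"
proof -
  define p where "p = prob {\<omega> \<in> space P. nn_encounter (int r) (int K) \<omega>}"
  define L where "L = int K + 2 * int r + 2"
  define g where "g = (\<lambda>(a, b). (L * int a, L * int b))"
  have "inj g" by (auto simp: inj_def g_def L_def)
  define S where "S z = {\<omega> \<in> space P. nn_encounter (int r) (int K) (T z \<omega>)}" for z
  have S_events: "S z \<in> events" for z
  proof -
    have "Measurable.pred P (\<lambda>\<omega>. nn_encounter (int r) (int K) (T z \<omega>))"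
      using measurable_compose[OF T_measurable nn_encounter_measurable] by simp
    then show ?thesis unfolding S_def by measurable
  qed
  have prob_S: "prob (S z) = p" for z
    unfolding S_def p_def by (rule prob_T) measurable
  \<comment> \<open>For \<open>0 < m\<close> the additive constants are absorbed into the factor
    \<open>m\<close>, so \<open>c * real m\<close> dominates
    \<open>8 * nat (L * int m + 2 * int r + 2) + 8\<close>.\<close>
  define c where "c = real_of_int (8 * (L + 2 * int r + 2) + 8)"
  have bound: "real m * real m * p \<le> c * real m" if "0 < m" for m
  proof -
    let ?D = "{..<m} \<times> {..<m}"
    let ?f = "\<lambda>\<omega>. \<Sum>d\<in>?D. indicat_real (S (g d)) \<omega>"
    have "AE \<omega> in P. ?f \<omega> \<le> c * real m"
      using AE_distinct_weights AE_finite_backward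
    proof eventually_elim
      case (elim \<omega>)
      interpret distinct_weights \<omega> by (rule elim(1))
      interpret lattice_flow F "nn_component \<omega>"
        using F_adj component_F by unfold_locales
      let ?J = "g ` {d \<in> ?D. \<omega> \<in> S (g d)}"
      have "?f \<omega> = real (card {d \<in> ?D. \<omega> \<in> S (g d)})"
        by (simp add: indicator_def sum.If_cases Int_def)
      also have "card {d \<in> ?D. \<omega> \<in> S (g d)} = card ?J"
        using \<open>inj g\<close> by (subst card_image) (auto intro: inj_on_subset)
      also have "card ?J \<le> 8 * nat (L * int m + 2 * int r + 2) + 8"
      proof (rule card_encounters_le[where K = "int K"])
        show "?J \<subseteq> (\<lambda>(a, b). (L * int a, L * int b)) ` ?D" by (auto simp: g_def)
        show "encounter F (nn_component \<omega>) (int r) (int K) z" if "z \<in> ?J" for z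
          using that elim(2) by (intro encounter_of_nn_encounter) (auto simp: S_def)
      qed (auto simp: L_def)
      also have "real (8 * nat (L * int m + 2 * int r + 2) + 8) \<le> c * real m"
      proof -
        have "0 \<le> L * int m" by (simp add: L_def)
        then have "real (8 * nat (L * int m + 2 * int r + 2) + 8) =
            8 * (of_int L * real m + 2 * real r + 2) + 8" by simp
        also have "\<dots> \<le> c * real m"
        proof -
          have "16 * real r + 24 \<le> (16 * real r + 24) * real m"
            using that by (simp add: mult_le_cancel_left1)
          then show ?thesis by (simp add: c_def algebra_simps)
        qed
        finally show ?thesis .
      qed
      finally show ?case by simp
    qed
    then have "expectation ?f \<le> c * real m"
      using S_events by (intro integral_le_const) (auto intro!: integrable_sum integrable_real_indicator simp: emeasure_eq_measure)
    moreover have "expectation ?f = (\<Sum>d\<in>?D. prob (S (g d)))"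
      using S_events by (subst Bochner_Integration.integral_sum) (auto simp: emeasure_eq_measure)
    ultimately show ?thesis by (simp add: prob_S)
  qed
  have "\<not> 0 < p"
  proof
    assume "0 < p"
    obtain m :: nat where m: "c / p < real m" using reals_Archimedean2 by blast
    have "0 \<le> c" by (simp add: c_def L_def)
    then have "0 \<le> c / p" using \<open>0 < p\<close> by simp
    then have "0 < real m" using m by linarith
    have "real m * p \<le> c"
      using bound[of m] \<open>0 < real m\<close> by (simp add: mult.assoc mult.left_commute[of _ _ p] mult.commute)
    then show False using m \<open>0 < p\<close> by (simp add: divide_less_eq)
  qed
  then show ?thesis using p_def measure_nonneg[of P] by (metis linorder_neqE_linordered_idom not_less)
qed

lemma AE_card_infinite_components_le:
  "AE \<omega> in P. finite (infinite_components \<omega>) \<and> card (infinite_components \<omega>) \<le> 2"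
proof -
  have "AE \<omega> in P. \<not> nn_encounter (int r) (int K) \<omega>" for r K :: nat
  proof -
    have "{\<omega> \<in> space P. nn_encounter (int r) (int K) \<omega>} \<in> events" by measurable
    then show ?thesis using prob_nn_encounter[of r K] by (simp add: prob_Collect_eq_0)
  qed
  then have "AE \<omega> in P. \<forall>r K :: nat. \<not> nn_encounter (int r) (int K) \<omega>"
    by (simp only: AE_all_countable simp_thms)
  with AE_distinct_weights AE_finite_backward show ?thesis
  proof eventually_elim
    case (elim \<omega>)
    interpret distinct_weights \<omega> by (rule elim(1))
    show ?case using elim by (intro card_infinite_components_le) auto
  qed
qed

end

theorem theorem2:
  fixes P :: "(vtx set \<Rightarrow> real) measure"
  assumes "prob_space P"
    and "sets P = sets Omega"
    and A1: "\<And>z. distr P P (T z) = P"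
    and A2: "\<And>e f. e \<in> E2 \<Longrightarrow> f \<in> E2 \<Longrightarrow> e \<noteq> f \<Longrightarrow>
               measure P {\<omega> \<in> space P. \<omega> e = \<omega> f} = 0"
  shows "AE \<omega> in P. finite (infinite_components \<omega>) \<and> card (infinite_components \<omega>) \<le> 2"
proof -
  interpret prob_space P by fact
  interpret stationary_weights P
    using assms(2) A1 A2 by unfold_locales
  show ?thesis by (rule AE_card_infinite_components_le)
qed

end
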